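(* Let $\gamma\in\mathbb R$ and let the coupling constant $\alpha>0$ be arbitrary. Then none of the points $\omega_0+E$, $\omega_1+E$ (when $E$ exists) and $\omega_0+F$, $\omega_1+F$ (when $F$ exists) can be an accumulation point of the discrete spectrum of the operator matrix $\mathcal A$.
   Context: Standing assumptions: $d\ge1$; $\omega:\mathbb R^d\to[0,\infty)$ is a non-constant, bounded, continuous function; $\lambda\in L^2(\mathbb R^d)$ is complex-valued and not identically zero (as an element of $L^2$). Put $\omega_0:=\inf_{\mathbb R^d}\omega$ and $\omega_1:=\sup_{\mathbb R^d}\omega$. Let $L^2_s(\mathbb R^d\times\mathbb R^d)$ be the subspace of symmetric functions in $L^2(\mathbb R^d\times\mathbb R^d)$, equipped with $\frac12$ times the inner product of the latter. For $\gamma\in\mathbb R$, $\alpha>0$ the operator matrix $\mathcal A=\begin{pmatrix}A&B\\ C&D\end{pmatrix}$ acts in $L^2(\mathbb R^d)\oplus L^2_s(\mathbb R^d\times\mathbb R^d)$ by $(Af)(k)=(-\gamma+\omega(k))f(k)$, $(Bg)(k)=\alpha\int_{\mathbb R^d} g(k,q)\lambda(q)\,dq$, $(Cf)(k,q)=\alpha\overline{\lambda(k)}f(q)+\alpha\overline{\lambda(q)}f(k)$, $(Dg)(k,q)=(\gamma+\omega(k)+\omega(q))g(k,q)$. It is bounded and self-adjoint. The discrete spectrum is the set of isolated eigenvalues of finite multiplicity. Let $\Phi(z)=-\gamma-z-\alpha^2\int\frac{|\lambda(q)|^2\,dq}{\omega(q)+\gamma-z}$ for $z\in(-\infty,\omega_0+\gamma)\cup(\omega_1+\gamma,\infty)$;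 it is strictly decreasing on each of the two intervals. $E=E(\gamma,\alpha)$ denotes the unique zero of $\Phi$ in $(-\infty,\omega_0+\gamma)$, whenever a zero exists there, and $F=F(\gamma,\alpha)$ the unique zero of $\Phi$ in $(\omega_1+\gamma,\infty)$, whenever a zero exists there. *)

theory Defs
  imports "HOL-Analysis.Analysis" "HOL-Library.Function_Algebras"
begin

text \<open>
  Elements of an L2 space are represented by Borel functions that are square integrable with
  respect to Lebesgue measure \<^term>\<open>lborel\<close>, and equality in L2 by almost-everywhere equality.
  Every Lebesgue-measurable function agrees almost everywhere with a Borel one, so this is the
  usual L2 space. Measure \<^term>\<open>lborel\<close> on a product type is the product of the Lebesgue
  measures. All scalars are complex; the library has no complex Hilbert spaces, so the
  operator-theoretic notions are defined here for the concrete space below.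
\<close>

definition L2 :: "('a::euclidean_space \<Rightarrow> complex) set" where
  "L2 = {f \<in> borel_measurable lborel. integrable lborel (\<lambda>x. (cmod (f x))\<^sup>2)}"

definition L2s :: "('a::euclidean_space \<times> 'a \<Rightarrow> complex) set" where
  "L2s = {g \<in> L2. AE p in lborel. g (fst p, snd p) = g (snd p, fst p)}"

definition L2_inner :: "('a::euclidean_space \<Rightarrow> complex) \<Rightarrow> ('a \<Rightarrow> complex) \<Rightarrow> complex" where
  "L2_inner f g = (LINT x|lborel. f x * cnj (g x))"

type_synonym 'a state = "('a \<Rightarrow> complex) \<times> ('a \<times> 'a \<Rightarrow> complex)"

definition hilb :: "'a::euclidean_space state set" where
  "hilb = L2 \<times> L2s"

definition hilb_inner :: "'a::euclidean_space state \<Rightarrow> 'a state \<Rightarrow> complex" where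
  "hilb_inner x y = L2_inner (fst x) (fst y) + L2_inner (snd x) (snd y) / 2"

definition hilb_norm :: "'a::euclidean_space state \<Rightarrow> real" where
  "hilb_norm x = sqrt (Re (hilb_inner x x))"

definition hilb_eq :: "'a::euclidean_space state \<Rightarrow> 'a state \<Rightarrow> bool"  (infix "\<approx>" 50) where
  "x \<approx> y \<longleftrightarrow> (AE k in lborel. fst x k = fst y k) \<and> (AE p in lborel. snd x p = snd y p)"

definition scale :: "complex \<Rightarrow> 'a state \<Rightarrow> 'a state" where
  "scale c x = (\<lambda>k. c * fst x k, \<lambda>p. c * snd x p)"


text \<open>
  Operators on the Hilbert space, acting on representatives. Addition of states is the pointwise
  one. Linearity and boundedness together imply that an operator respects \<open>\<approx>\<close>.
\<close>

definition bounded_operator :: "('a::euclidean_space state \<Rightarrow> 'a state) \<Rightarrow> bool" where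
  "bounded_operator T \<longleftrightarrow>
     (\<forall>x\<in>hilb. T x \<in> hilb) \<and>
     (\<forall>x\<in>hilb. \<forall>y\<in>hilb. T (x + y) \<approx> T x + T y) \<and>
     (\<forall>c. \<forall>x\<in>hilb. T (scale c x) \<approx> scale c (T x)) \<and>
     (\<exists>K. \<forall>x\<in>hilb. hilb_norm (T x) \<le> K * hilb_norm x)"

definition resolvent_set :: "('a::euclidean_space state \<Rightarrow> 'a state) \<Rightarrow> complex set" where
  "resolvent_set T = {z. \<exists>R. bounded_operator R \<and>
     (\<forall>x\<in>hilb. R (T x - scale z x) \<approx> x) \<and>
     (\<forall>x\<in>hilb. T (R x) - scale z (R x) \<approx> x)}"

definition spectrum :: "('a::euclidean_space state \<Rightarrow> 'a state) \<Rightarrow> complex set" where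
  "spectrum T = - resolvent_set T"

definition eigenspace :: "('a::euclidean_space state \<Rightarrow> 'a state) \<Rightarrow> complex \<Rightarrow> 'a state set" where
  "eigenspace T z = {x \<in> hilb. T x \<approx> scale z x}"

definition eigenvalue :: "('a::euclidean_space state \<Rightarrow> 'a state) \<Rightarrow> complex \<Rightarrow> bool" where
  "eigenvalue T z \<longleftrightarrow> (\<exists>x\<in>eigenspace T z. \<not> x \<approx> 0)"

definition finite_multiplicity :: "('a::euclidean_space state \<Rightarrow> 'a state) \<Rightarrow> complex \<Rightarrow> bool" where
  "finite_multiplicity T z \<longleftrightarrow>
     (\<exists>S. finite S \<and> S \<subseteq> eigenspace T z \<and>
        (\<forall>x\<in>eigenspace T z. \<exists>c. x \<approx> (\<Sum>s\<in>S. scale (c s) s)))"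

definition discrete_spectrum :: "('a::euclidean_space state \<Rightarrow> 'a state) \<Rightarrow> complex set" where
  "discrete_spectrum T =
     {z. z isolated_in spectrum T \<and> eigenvalue T z \<and> finite_multiplicity T z}"


definition opA :: "('a \<Rightarrow> real) \<Rightarrow> real \<Rightarrow> ('a \<Rightarrow> complex) \<Rightarrow> 'a \<Rightarrow> complex" where
  "opA \<omega> \<gamma> f = (\<lambda>k. complex_of_real (- \<gamma> + \<omega> k) * f k)"

definition opB ::
  "('a::euclidean_space \<Rightarrow> complex) \<Rightarrow> real \<Rightarrow> ('a \<times> 'a \<Rightarrow> complex) \<Rightarrow> 'a \<Rightarrow> complex" where
  "opB lam \<alpha> g = (\<lambda>k. complex_of_real \<alpha> * (LINT q|lborel. g (k, q) * lam q))"

definition opC ::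
  "('a \<Rightarrow> complex) \<Rightarrow> real \<Rightarrow> ('a \<Rightarrow> complex) \<Rightarrow> 'a \<times> 'a \<Rightarrow> complex" where
  "opC lam \<alpha> f = (\<lambda>(k, q). complex_of_real \<alpha> * cnj (lam k) * f q
                          + complex_of_real \<alpha> * cnj (lam q) * f k)"

definition opD :: "('a \<Rightarrow> real) \<Rightarrow> real \<Rightarrow> ('a \<times> 'a \<Rightarrow> complex) \<Rightarrow> 'a \<times> 'a \<Rightarrow> complex" where
  "opD \<omega> \<gamma> g = (\<lambda>(k, q). complex_of_real (\<gamma> + \<omega> k + \<omega> q) * g (k, q))"

definition op_matrix ::
  "('a::euclidean_space \<Rightarrow> real) \<Rightarrow> ('a \<Rightarrow> complex) \<Rightarrow> real \<Rightarrow> real \<Rightarrow> 'a state \<Rightarrow> 'a state" where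
  "op_matrix \<omega> lam \<gamma> \<alpha> x =
     (opA \<omega> \<gamma> (fst x) + opB lam \<alpha> (snd x), opC lam \<alpha> (fst x) + opD \<omega> \<gamma> (snd x))"

text \<open>
  Only the values for \<open>z\<close> below \<open>inf \<omega> + \<gamma>\<close> or above \<open>sup \<omega> + \<gamma>\<close>
  are meaningful.
\<close>

definition Phi ::
  "('a::euclidean_space \<Rightarrow> real) \<Rightarrow> ('a \<Rightarrow> complex) \<Rightarrow> real \<Rightarrow> real \<Rightarrow> real \<Rightarrow> real" where
  "Phi \<omega> lam \<gamma> \<alpha> z =
     - \<gamma> - z - \<alpha>\<^sup>2 * (LINT q|lborel. (cmod (lam q))\<^sup>2 / (\<omega> q + \<gamma> - z))"

end

theory Submission
  imports Defs
begin

text \<open>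
  Eliminating the two-particle component turns the eigenvalue equation into \<open>S z f = 0\<close>, where
  \<open>S z\<close> is multiplication by \<open>\<Phi>(z - \<omega>(k))\<close> minus \<open>\<alpha>\<^sup>2\<close> times the integral operator with kernel
  \<open>cnj (\<lambda>(k)) \<lambda>(q) / (\<omega>(k) + \<omega>(q) + \<gamma> - z)\<close>, which is positive for \<open>z < 2 \<omega>\<^sub>0 + \<gamma>\<close>.
  Weyl sequences show that \<open>(2 \<omega>\<^sub>0 + \<gamma>, 2 \<omega>\<^sub>1 + \<gamma>)\<close> and \<open>(\<omega>\<^sub>0 + E, \<omega>\<^sub>1 + E)\<close> contain no isolated point of
  the spectrum, so only eigenvalues in \<open>(\<omega>\<^sub>1 + E, 2 \<omega>\<^sub>0 + \<gamma>)\<close> or below \<open>\<omega>\<^sub>0 + E\<close> matter. On the former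
  interval \<open>\<Phi>(z - \<omega>)\<close> is negative and so is \<open>S z\<close>: there are none. If \<open>N\<close> eigenvalues lie below \<open>\<omega>\<^sub>0 + E\<close>,
  then, \<open>S\<close> being strictly decreasing in \<open>z\<close>, the form of \<open>S (\<omega>\<^sub>0 + E)\<close> is negative on a space of
  dimension \<open>N\<close>. But up to finite rank the kernel at \<open>\<omega>\<^sub>0 + E\<close> vanishes at \<open>\<omega> = \<omega>\<^sub>0\<close> fast enough to be
  dominated by \<open>\<Phi>(\<omega>\<^sub>0 + E - \<omega>) \<ge> \<omega> - \<omega>\<^sub>0\<close>, which bounds \<open>N\<close>.
  The thresholds at \<open>F\<close> reduce to those at \<open>E\<close> by reflecting \<open>z\<close>, \<open>\<omega>\<close> and \<open>\<gamma>\<close>.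
\<close>

section \<open>Square integrable functions\<close>

lemma L2_D:
  assumes "f \<in> L2"
  shows "f \<in> borel_measurable borel" "integrable lborel (\<lambda>x. (cmod (f x))\<^sup>2)"
  using assms by (auto simp: L2_def)

lemma L2_I:
  assumes "f \<in> borel_measurable borel" "integrable lborel (\<lambda>x. (cmod (f x))\<^sup>2)"
  shows "f \<in> L2"
  using assms by (auto simp: L2_def)

lemma fst_borel [measurable]: "(fst :: 'a::euclidean_space \<times> 'b::euclidean_space \<Rightarrow> 'a) \<in> borel_measurable borel"
  and snd_borel [measurable]: "(snd :: 'a::euclidean_space \<times> 'b::euclidean_space \<Rightarrow> 'b) \<in> borel_measurable borel"
  by (auto intro!: borel_measurable_continuous_onI continuous_intros)

lemma L2_mult_integrable:
  assumes "f \<in> L2" "g \<in> L2"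
  shows "integrable lborel (\<lambda>x. cmod (f x) * cmod (g x))" "integrable lborel (\<lambda>x. f x * g x)"
proof -
  note [measurable] = assms[THEN L2_D(1)]
  have int: "integrable lborel (\<lambda>x. (cmod (f x))\<^sup>2 + (cmod (g x))\<^sup>2)"
    using assms[THEN L2_D(2)] by simp
  have le: "cmod (f x) * cmod (g x) \<le> (cmod (f x))\<^sup>2 + (cmod (g x))\<^sup>2" for x
    using sum_squares_bound[of "cmod (f x)" "cmod (g x)"]
      mult_nonneg_nonneg[of "cmod (f x)" "cmod (g x)", OF norm_ge_zero norm_ge_zero]
    unfolding mult.assoc by linarith
  show "integrable lborel (\<lambda>x. cmod (f x) * cmod (g x))"
    by (rule Bochner_Integration.integrable_bound[OF int]) (use le in \<open>auto intro!: AE_I2\<close>)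
  show "integrable lborel (\<lambda>x. f x * g x)"
    by (rule Bochner_Integration.integrable_bound[OF int]) (use le in \<open>auto simp: norm_mult intro!: AE_I2\<close>)
qed

lemma L2_mult_bounded:
  fixes h :: "'a::euclidean_space \<Rightarrow> complex"
  assumes "f \<in> L2" "h \<in> borel_measurable borel" "\<And>x. cmod (h x) \<le> K"
  shows "(\<lambda>x. h x * f x) \<in> L2"
proof (rule L2_I)
  note [measurable] = assms(1)[THEN L2_D(1)] assms(2)
  show "(\<lambda>x. h x * f x) \<in> borel_measurable borel" by measurable
  have int: "integrable lborel (\<lambda>x. K\<^sup>2 * (cmod (f x))\<^sup>2)"
    using assms(1)[THEN L2_D(2)] by simp
  show "integrable lborel (\<lambda>x. (cmod (h x * f x))\<^sup>2)"
    by (rule Bochner_Integration.integrable_bound[OF int])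
      (use assms(3) in \<open>auto simp: norm_mult power_mult_distrib intro!: AE_I2 mult_right_mono power_mono\<close>)
qed

lemma L2_add:
  assumes "f \<in> L2" "g \<in> L2"
  shows "(\<lambda>x. f x + g x) \<in> L2"
proof (rule L2_I)
  note [measurable] = assms[THEN L2_D(1)]
  show "(\<lambda>x. f x + g x) \<in> borel_measurable borel" by measurable
  have int: "integrable lborel (\<lambda>x. 2 * (cmod (f x))\<^sup>2 + 2 * (cmod (g x))\<^sup>2)"
    using assms[THEN L2_D(2)] by simp
  have "(cmod (f x + g x))\<^sup>2 \<le> 2 * (cmod (f x))\<^sup>2 + 2 * (cmod (g x))\<^sup>2" for x
  proof -
    have "(cmod (f x + g x))\<^sup>2 \<le> (cmod (f x) + cmod (g x))\<^sup>2"
      by (intro power_mono norm_triangle_ineq) auto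
    also have "\<dots> \<le> 2 * (cmod (f x))\<^sup>2 + 2 * (cmod (g x))\<^sup>2"
      using sum_squares_bound[of "cmod (f x)" "cmod (g x)"] by (simp add: power2_sum)
    finally show ?thesis .
  qed
  then show "integrable lborel (\<lambda>x. (cmod (f x + g x))\<^sup>2)"
    by (intro Bochner_Integration.integrable_bound[OF int]) (auto intro!: AE_I2)
qed

lemma L2_scale: "f \<in> L2 \<Longrightarrow> (\<lambda>x. c * f x) \<in> L2"
  by (rule L2_mult_bounded[where K="cmod c"]) auto

lemma L2_zero: "(\<lambda>x. 0) \<in> L2"
  by (rule L2_I) auto

lemma L2_cnj: "f \<in> L2 \<Longrightarrow> (\<lambda>x. cnj (f x)) \<in> L2"
  by (auto simp: L2_def intro: measurable_compose[OF _ borel_measurable_continuous_onI[OF continuous_on_cnj[OF continuous_on_id]]])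

lemma L2_sum:
  "finite A \<Longrightarrow> (\<And>i. i \<in> A \<Longrightarrow> f i \<in> L2) \<Longrightarrow> (\<lambda>x. \<Sum>i\<in>A. c i * f i x) \<in> L2"
  by (induction A rule: finite_induct) (auto intro!: L2_zero L2_add L2_scale)

text \<open>Integrating the square of \<open>B * |f| - A * |g|\<close> gives
  \<open>A * (A * C - B\<^sup>2) \<ge> 0\<close>. If \<open>A = 0\<close> then \<open>f\<close>
  vanishes almost everywhere and so does the product; otherwise \<open>A\<close> can be
  cancelled.\<close>

lemma L2_Cauchy_Schwarz:
  assumes "f \<in> L2" "g \<in> L2"
  shows "(LINT x|lborel. cmod (f x) * cmod (g x))\<^sup>2
    \<le> (LINT x|lborel. (cmod (f x))\<^sup>2) * (LINT x|lborel. (cmod (g x))\<^sup>2)"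
proof -
  define A where "A = (LINT x|lborel. (cmod (f x))\<^sup>2)"
  define B where "B = (LINT x|lborel. cmod (f x) * cmod (g x))"
  define C where "C = (LINT x|lborel. (cmod (g x))\<^sup>2)"
  note int[simp] = assms[THEN L2_D(2)] L2_mult_integrable(1)[OF assms]
  have "A \<ge> 0" by (simp add: A_def)
  have "0 \<le> (LINT x|lborel. (B * cmod (f x) - A * cmod (g x))\<^sup>2)"
    by simp
  also have "\<dots> = (LINT x|lborel. B\<^sup>2 * (cmod (f x))\<^sup>2 - 2 * A * B * (cmod (f x) * cmod (g x))
      + A\<^sup>2 * (cmod (g x))\<^sup>2)"
    by (intro Bochner_Integration.integral_cong) (auto simp: power2_eq_square algebra_simps)
  also have "\<dots> = B\<^sup>2 * A - 2 * A * B * B + A\<^sup>2 * C"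
    by (simp add: A_def B_def C_def)
  finally have *: "0 \<le> A * (A * C - B\<^sup>2)"
    by (simp add: power2_eq_square algebra_simps)
  show ?thesis
  proof (cases "A = 0")
    case True
    then have "AE x in lborel. (cmod (f x))\<^sup>2 = 0"
      using integral_nonneg_eq_0_iff_AE[OF int(1)] by (simp add: A_def)
    then have "B = (LINT x|(lborel::'a measure). 0)"
      unfolding B_def by (intro integral_cong_AE) (use assms[THEN L2_D(1)] in auto)
    then show ?thesis using True by (simp add: A_def B_def)
  next
    case False
    then have "A > 0" using \<open>A \<ge> 0\<close> by simp
    then have "B\<^sup>2 \<le> A * C" using * by (simp add: zero_le_mult_iff)
    then show ?thesis by (simp add: A_def B_def C_def)
  qed
qed

lemma L2_tensor:
  fixes f h :: "'a::euclidean_space \<Rightarrow> complex"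
  assumes "f \<in> L2" "h \<in> L2"
  shows "(\<lambda>p. f (fst p) * h (snd p)) \<in> L2"
proof (rule L2_I)
  note [measurable] = assms[THEN L2_D(1)]
  show m: "(\<lambda>p. f (fst p) * h (snd p)) \<in> borel_measurable borel" by measurable
  have "integrable (lborel \<Otimes>\<^sub>M lborel) (\<lambda>p. (cmod (f (fst p) * h (snd p)))\<^sup>2)"
  proof (rule lborel_pair.Fubini_integrable)
    show "(\<lambda>p. (cmod (f (fst p) * h (snd p)))\<^sup>2) \<in> borel_measurable (lborel \<Otimes>\<^sub>M lborel)"
      unfolding lborel_prod using m by simp
  qed (use assms[THEN L2_D(2)] in \<open>auto simp: norm_mult power_mult_distrib\<close>)
  then show "integrable lborel (\<lambda>p. (cmod (f (fst p) * h (snd p)))\<^sup>2)"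
    by (simp add: lborel_prod)
qed

section \<open>Exchange of variables and adjointness of the coupling operators\<close>

lemma lborel_swap:
  fixes u :: "'a::euclidean_space \<times> 'a \<Rightarrow> complex"
  assumes "u \<in> borel_measurable borel"
  shows "(LINT p|lborel. u (snd p, fst p)) = (LINT p|lborel. u p)"
    "integrable lborel u \<Longrightarrow> integrable lborel (\<lambda>p. u (snd p, fst p))"
proof -
  have "u \<in> borel_measurable (lborel \<Otimes>\<^sub>M lborel)" unfolding lborel_prod using assms by simp
  from lborel_pair.integral_product_swap[OF this]
  show "(LINT p|lborel. u (snd p, fst p)) = (LINT p|lborel. u p)"
    by (simp add: lborel_prod case_prod_unfold)
  show "integrable lborel u \<Longrightarrow> integrable lborel (\<lambda>p. u (snd p, fst p))"
    using lborel_pair.integrable_product_swap[of u] by (simp add: lborel_prod case_prod_unfold)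
qed

lemma opC_L2s:
  assumes "lam \<in> L2" "f \<in> L2"
  shows "opC lam \<alpha> f \<in> L2s"
proof -
  have "(\<lambda>p. complex_of_real \<alpha> * (cnj (lam (fst p)) * f (snd p))
        + complex_of_real \<alpha> * (f (fst p) * cnj (lam (snd p)))) \<in> L2"
    using assms by (intro L2_add L2_scale L2_tensor L2_cnj)
  then show ?thesis
    by (simp add: L2s_def opC_def case_prod_unfold mult_ac add_ac)
qed

text \<open>The factor 1/2 is the one in the inner product of the symmetric sector.\<close>

lemma opB_opC_adjoint:
  fixes lam f :: "'a::euclidean_space \<Rightarrow> complex"
  assumes g: "g \<in> L2s" and lam: "lam \<in> L2" and f: "f \<in> L2"
  shows "integrable lborel (\<lambda>k. opB lam \<alpha> g k * cnj (f k))"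
    "(LINT k|lborel. opB lam \<alpha> g k * cnj (f k)) = (LINT p|lborel. g p * cnj (opC lam \<alpha> f p)) / 2"
proof -
  have g2: "g \<in> L2" and sym: "AE p in lborel. g (fst p, snd p) = g (snd p, fst p)"
    using g by (auto simp: L2s_def)
  define u where "u = (\<lambda>p. complex_of_real \<alpha> * (g p * (cnj (f (fst p)) * lam (snd p))))"
  have ua: "u = (\<lambda>p. (complex_of_real \<alpha> * cnj (f (fst p))) * (g p * lam (snd p)))"
    by (simp add: u_def mult_ac)
  have u: "integrable lborel u"
    unfolding u_def by (intro integrable_mult_right L2_mult_integrable(2) g2 L2_tensor L2_cnj f lam)
  then have um: "u \<in> borel_measurable borel" by simp
  have u': "integrable (lborel \<Otimes>\<^sub>M lborel) u" using u by (simp add: lborel_prod)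
  have eq: "opB lam \<alpha> g k * cnj (f k) = (LINT q|lborel. u (k, q))" for k
    unfolding opB_def ua fst_conv snd_conv integral_mult_right_zero by simp
  show "integrable lborel (\<lambda>k. opB lam \<alpha> g k * cnj (f k))"
    unfolding eq using lborel_pair.integrable_fst'[OF u'] .
  have 1: "(LINT k|lborel. opB lam \<alpha> g k * cnj (f k)) = (LINT p|lborel. u p)"
    unfolding eq using lborel_pair.integral_fst'[OF u'] by (simp add: lborel_prod)
  note us = lborel_swap[OF um]
  \<comment> \<open>Symmetry of \<open>g\<close> turns the two summands of \<open>C f\<close> into
    \<open>u\<close> and its swap. Their integrals agree, which produces the factor 2.\<close>
  have "AE p in lborel. g p * cnj (opC lam \<alpha> f p) = u p + u (snd p, fst p)"
    using sym by eventually_elim (auto simp: opC_def u_def case_prod_unfold algebra_simps)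
  then have "(LINT p|lborel. g p * cnj (opC lam \<alpha> f p)) = (LINT p|lborel. u p + u (snd p, fst p))"
  proof (intro integral_cong_AE)
    show "(\<lambda>p. u p + u (snd p, fst p)) \<in> borel_measurable lborel"
      using u us(2)[OF u] by (intro borel_measurable_integrable) simp
    have "opC lam \<alpha> f \<in> L2" using opC_L2s[OF lam f] by (simp add: L2s_def)
    then show "(\<lambda>p. g p * cnj (opC lam \<alpha> f p)) \<in> borel_measurable lborel"
      by (intro borel_measurable_integrable L2_mult_integrable(2) g2 L2_cnj)
  qed auto
  also have "\<dots> = 2 * (LINT p|lborel. u p)"
    using u us by simp
  finally show "(LINT k|lborel. opB lam \<alpha> g k * cnj (f k)) = (LINT p|lborel. g p * cnj (opC lam \<alpha> f p)) / 2"
    using 1 by simp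
qed

section \<open>The Schur complement\<close>

text \<open>The thresholds at \<open>E\<close> use \<open>a = - \<gamma>\<close>, \<open>b = \<gamma>\<close>. Replacing \<open>\<omega>\<close>, \<open>\<gamma>\<close>, \<open>z\<close> by their negatives turns \<open>S z\<close>
  into \<open>- S z\<close> if \<open>a = \<gamma>\<close>, \<open>b = - \<gamma>\<close>, which is why \<open>a\<close> and \<open>b\<close> are independent and \<open>\<omega>\<close> has no sign.\<close>

locale schur =
  fixes \<omega> :: "'a::euclidean_space \<Rightarrow> real" and lam :: "'a \<Rightarrow> complex" and \<alpha> a b lo hi :: real
  assumes \<omega>_meas [measurable]: "\<omega> \<in> borel_measurable borel"
    and lo: "\<And>k. lo \<le> \<omega> k" and hi: "\<And>k. \<omega> k \<le> hi"
    and lam: "lam \<in> L2"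
begin

text \<open>The distance of \<open>z\<close> from the range of
  \<open>\<omega> k + \<omega> q + b\<close> is at least \<open>s\<close>, so \<open>D - z\<close>
  has an inverse of norm at most \<open>1 / s\<close>. The absolute value admits \<open>z\<close> on
  either side of that range.\<close>

definition gap :: "real \<Rightarrow> real \<Rightarrow> bool" where
  "gap z s \<longleftrightarrow> s > 0 \<and> (\<forall>k q. s \<le> \<bar>\<omega> k + \<omega> q + b - z\<bar>)"

text \<open>This is \<open>(D - z)^-1 C f\<close>, where \<open>D\<close> is multiplication by
  \<open>\<omega> k + \<omega> q + b\<close>.\<close>

definition resC :: "real \<Rightarrow> ('a \<Rightarrow> complex) \<Rightarrow> 'a \<times> 'a \<Rightarrow> complex" where
  "resC z f = (\<lambda>p. opC lam \<alpha> f p / complex_of_real (\<omega> (fst p) + \<omega> (snd p) + b - z))"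

text \<open>For \<open>a = - b\<close> this is the Schur complement
  \<open>A - z - B (D - z)^-1 C\<close> of the operator matrix with
  \<open>\<gamma> = b\<close>.\<close>

definition S :: "real \<Rightarrow> ('a \<Rightarrow> complex) \<Rightarrow> 'a \<Rightarrow> complex" where
  "S z f = (\<lambda>k. complex_of_real (a + \<omega> k - z) * f k - opB lam \<alpha> (resC z f) k)"

text \<open>The sesquilinear form of \<open>S z\<close>, with the coupling term moved to the
  two-particle sector, weight 1/2 included. In this shape hermitian symmetry and monotonicity in
  \<open>z\<close> follow from the real denominators.\<close>

definition form :: "real \<Rightarrow> ('a \<Rightarrow> complex) \<Rightarrow> ('a \<Rightarrow> complex) \<Rightarrow> complex" where
  "form z f h = (LINT k|lborel. complex_of_real (a + \<omega> k - z) * f k * cnj (h k))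
     - (LINT p|lborel. resC z f p * cnj (opC lam \<alpha> h p)) / 2"

text \<open>For \<open>a = - \<gamma>\<close> and \<open>b = \<gamma>\<close> this is
  \<open>Phi \<omega> lam \<gamma> \<alpha>\<close>.\<close>

definition phi :: "real \<Rightarrow> real" where
  "phi z = a - z - \<alpha>\<^sup>2 * (LINT q|lborel. (cmod (lam q))\<^sup>2 / (\<omega> q + b - z))"

text \<open>The integral operator in \<open>S z\<close> without its outer factor
  \<open>\<alpha>\<^sup>2 * cnj (lam k)\<close>. For square integrable \<open>f\<close> and
  \<open>z\<close> with a gap it is a bounded function of \<open>k\<close>.\<close>

definition pot :: "real \<Rightarrow> ('a \<Rightarrow> complex) \<Rightarrow> 'a \<Rightarrow> complex" where
  "pot z f k = (LINT q|lborel. lam q * f q / complex_of_real (\<omega> k + \<omega> q + b - z))"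

lemma gap_below: "z < 2 * lo + b \<Longrightarrow> gap z (2 * lo + b - z)"
  unfolding gap_def using lo by (smt (verit))

lemma lam_meas [measurable]: "lam \<in> borel_measurable borel"
  using lam by (rule L2_D)

lemma lam_nsq_integrable: "integrable lborel (\<lambda>q. (cmod (lam q))\<^sup>2)"
  using lam by (rule L2_D)

lemma \<omega>_bounded: "\<bar>\<omega> k\<bar> \<le> \<bar>lo\<bar> + \<bar>hi\<bar>"
  using lo[of k] hi[of k] by linarith

lemma inverse_gap_bound:
  assumes "gap z s"
  shows "cmod (1 / complex_of_real (\<omega> k + \<omega> q + b - z)) \<le> 1 / s"
  using assms by (simp add: gap_def norm_divide divide_simps flip: of_real_add of_real_diff)

lemma L2_diag: "f \<in> L2 \<Longrightarrow> (\<lambda>k. complex_of_real (a + \<omega> k - z) * f k) \<in> L2"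
  by (rule L2_mult_bounded[where K="\<bar>a\<bar> + \<bar>z\<bar> + \<bar>lo\<bar> + \<bar>hi\<bar>"])
    (use \<omega>_bounded in \<open>auto simp del: of_real_add of_real_diff, smt (verit)\<close>)

lemma opC_L2: "f \<in> L2 \<Longrightarrow> opC lam \<alpha> f \<in> L2"
  using opC_L2s[OF lam] by (auto simp: L2s_def)

lemma resC_L2s:
  assumes "gap z s" "f \<in> L2"
  shows "resC z f \<in> L2s"
proof -
  have "(\<lambda>p. (1 / complex_of_real (\<omega> (fst p) + \<omega> (snd p) + b - z)) * opC lam \<alpha> f p) \<in> L2"
    by (rule L2_mult_bounded[OF opC_L2[OF assms(2)] _ inverse_gap_bound[OF assms(1)]]) measurable
  then show ?thesis
    by (simp add: L2s_def resC_def opC_def case_prod_unfold add_ac)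
qed

lemma resC_L2: "gap z s \<Longrightarrow> f \<in> L2 \<Longrightarrow> resC z f \<in> L2"
  using resC_L2s by (auto simp: L2s_def)

section \<open>The hermitian form of the Schur complement\<close>

lemma form_eq:
  assumes z: "gap z s" and f: "f \<in> L2" and h: "h \<in> L2"
  shows "integrable lborel (\<lambda>k. S z f k * cnj (h k))"
    "form z f h = (LINT k|lborel. S z f k * cnj (h k))"
proof -
  note adj = opB_opC_adjoint[OF resC_L2s[OF z f] lam h, of \<alpha>]
  have i: "integrable lborel (\<lambda>k. complex_of_real (a + \<omega> k - z) * f k * cnj (h k))"
    by (intro L2_mult_integrable(2) L2_diag L2_cnj f h)
  have eq: "S z f k * cnj (h k) = complex_of_real (a + \<omega> k - z) * f k * cnj (h k)
      - opB lam \<alpha> (resC z f) k * cnj (h k)" for k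
    by (simp add: S_def algebra_simps)
  show "integrable lborel (\<lambda>k. S z f k * cnj (h k))"
    unfolding eq using i adj by simp
  show "form z f h = (LINT k|lborel. S z f k * cnj (h k))"
    unfolding eq form_def using i adj by simp
qed

lemma form_hermitian: "form z h f = cnj (form z f h)"
proof -
  have "complex_of_real (a + \<omega> k - z) * h k * cnj (f k)
      = cnj (complex_of_real (a + \<omega> k - z) * f k * cnj (h k))" for k
    by simp
  then have 1: "(LINT k|lborel. complex_of_real (a + \<omega> k - z) * h k * cnj (f k))
      = cnj (LINT k|lborel. complex_of_real (a + \<omega> k - z) * f k * cnj (h k))"
    by (simp only: Bochner_Integration.integral_cnj)
  have "resC z h p * cnj (opC lam \<alpha> f p) = cnj (resC z f p * cnj (opC lam \<alpha> h p))" for p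
    by (simp add: resC_def)
  then have 2: "(LINT p|lborel. resC z h p * cnj (opC lam \<alpha> f p))
      = cnj (LINT p|lborel. resC z f p * cnj (opC lam \<alpha> h p))"
    by (simp only: Bochner_Integration.integral_cnj)
  show ?thesis unfolding form_def 1 2 by simp
qed

lemma form_linear:
  assumes z: "gap z s" and u: "u \<in> L2" and f: "f \<in> L2" and h: "h \<in> L2"
  shows "form z (\<lambda>k. u k + c * f k) h = form z u h + c * form z f h"
proof -
  note i1 = L2_mult_integrable(2)[OF L2_diag L2_cnj[OF h]]
  note i2 = L2_mult_integrable(2)[OF resC_L2[OF z] L2_cnj[OF opC_L2[OF h]]]
  have r: "resC z (\<lambda>k. u k + c * f k) p = resC z u p + c * resC z f p" for p
    by (simp add: resC_def opC_def case_prod_unfold algebra_simps add_divide_distrib)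
  have "(LINT k|lborel. complex_of_real (a + \<omega> k - z) * (u k + c * f k) * cnj (h k))
     = (LINT k|lborel. complex_of_real (a + \<omega> k - z) * u k * cnj (h k)
         + c * (complex_of_real (a + \<omega> k - z) * f k * cnj (h k)))"
    by (simp add: algebra_simps)
  also have "\<dots> = (LINT k|lborel. complex_of_real (a + \<omega> k - z) * u k * cnj (h k))
         + c * (LINT k|lborel. complex_of_real (a + \<omega> k - z) * f k * cnj (h k))"
    using i1[OF u] i1[OF f] by simp
  finally have 1: "(LINT k|lborel. complex_of_real (a + \<omega> k - z) * (u k + c * f k) * cnj (h k)) = \<dots>" .
  have "(LINT p|lborel. resC z (\<lambda>k. u k + c * f k) p * cnj (opC lam \<alpha> h p))
     = (LINT p|lborel. resC z u p * cnj (opC lam \<alpha> h p) + c * (resC z f p * cnj (opC lam \<alpha> h p)))"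
    by (simp add: r algebra_simps)
  also have "\<dots> = (LINT p|lborel. resC z u p * cnj (opC lam \<alpha> h p))
      + c * (LINT p|lborel. resC z f p * cnj (opC lam \<alpha> h p))"
    using i2[OF u] i2[OF f] by simp
  finally show ?thesis
    unfolding form_def 1 by (simp add: algebra_simps add_divide_distrib)
qed

text \<open>A kernel vector is orthogonal to everything with respect to the form in the first slot,
  and by hermitian symmetry in the second, so all terms containing it drop out.\<close>

lemma form_add_kernel:
  assumes z: "gap z s" and u: "u \<in> L2" and f: "f \<in> L2" and ker: "AE k in lborel. S z f k = 0"
  shows "form z (\<lambda>k. u k + c * f k) (\<lambda>k. u k + c * f k) = form z u u"
proof -
  have v: "(\<lambda>k. u k + c * f k) \<in> L2" by (intro L2_add L2_scale u f)
  have ker: "form z f h = 0" if "h \<in> L2" for h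
  proof -
    have "(LINT k|lborel. S z f k * cnj (h k)) = (LINT k|(lborel::'a measure). 0)"
      by (intro integral_cong_AE borel_measurable_integrable form_eq[OF z f that]) (use ker in auto)
    then show ?thesis by (simp add: form_eq[OF z f that])
  qed
  have "form z (\<lambda>k. u k + c * f k) (\<lambda>k. u k + c * f k) = form z u (\<lambda>k. u k + c * f k)"
    by (simp add: form_linear[OF z u f v] ker[OF v])
  also have "\<dots> = cnj (form z (\<lambda>k. u k + c * f k) u)" by (rule form_hermitian)
  also have "\<dots> = cnj (form z u u)"
    by (simp add: form_linear[OF z u f u] ker[OF u])
  also have "\<dots> = form z u u" by (simp add: form_hermitian[of z u u, symmetric])
  finally show ?thesis .
qed

lemma form_ae_zero:
  assumes z: "gap z s" and f: "f \<in> L2" and "AE k in lborel. f k = 0"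
  shows "form z f f = 0"
proof -
  have "(LINT k|lborel. S z f k * cnj (f k)) = (LINT k|(lborel::'a measure). 0)"
    by (intro integral_cong_AE borel_measurable_integrable form_eq[OF z f f]) (use assms(3) in auto)
  then show ?thesis by (simp add: form_eq[OF z f f])
qed

text \<open>The multiplier part drops by exactly \<open>z' - z\<close> times the squared norm. The
  denominators \<open>\<omega> k + \<omega> q + b - z\<close> are positive and shrink as
  \<open>z\<close> grows, so the subtracted coupling part can only increase.\<close>

lemma form_antimono:
  assumes f: "f \<in> L2" and z: "z \<le> z'" "z' < 2 * lo + b"
  shows "Re (form z' f f) \<le> Re (form z f f) - (z' - z) * (LINT k|lborel. (cmod (f k))\<^sup>2)"
proof -
  have g: "gap z (2 * lo + b - z)" "gap z' (2 * lo + b - z')"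
    using z by (auto intro!: gap_below)
  note d1 = L2_mult_integrable(2)[OF L2_diag[OF f] L2_cnj[OF f]]
  note d2 = L2_mult_integrable(2)[OF resC_L2[OF g(1) f] L2_cnj[OF opC_L2[OF f]]]
    L2_mult_integrable(2)[OF resC_L2[OF g(2) f] L2_cnj[OF opC_L2[OF f]]]
  have "(LINT k|lborel. complex_of_real (a + \<omega> k - z) * f k * cnj (f k))
     - (LINT k|lborel. complex_of_real (a + \<omega> k - z') * f k * cnj (f k))
     = (LINT k|lborel. complex_of_real (a + \<omega> k - z) * f k * cnj (f k)
        - complex_of_real (a + \<omega> k - z') * f k * cnj (f k))"
    by (rule Bochner_Integration.integral_diff[symmetric]) (rule d1)+
  also have "\<dots> = (LINT k|lborel. complex_of_real ((z' - z) * (cmod (f k))\<^sup>2))"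
    by (intro Bochner_Integration.integral_cong refl) (simp only: of_real_mult complex_norm_square, simp add: algebra_simps)
  also have "\<dots> = complex_of_real ((z' - z) * (LINT k|lborel. (cmod (f k))\<^sup>2))"
    by (simp only: integral_complex_of_real integral_mult_right_zero)
  finally have 1: "Re (LINT k|lborel. complex_of_real (a + \<omega> k - z) * f k * cnj (f k))
     - Re (LINT k|lborel. complex_of_real (a + \<omega> k - z') * f k * cnj (f k))
     = (z' - z) * (LINT k|lborel. (cmod (f k))\<^sup>2)"
    by (metis Re_complex_of_real minus_complex.sel(1))
  have "Re (LINT p|lborel. resC z f p * cnj (opC lam \<alpha> f p))
      = (LINT p|lborel. Re (resC z f p * cnj (opC lam \<alpha> f p)))"
    using d2 by (simp del: times_complex.sel)
  also have "\<dots> \<le> (LINT p|lborel. Re (resC z' f p * cnj (opC lam \<alpha> f p)))"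
  proof (rule integral_mono)
    fix p :: "'a \<times> 'a"
    have Re: "Re (resC t f p * cnj (opC lam \<alpha> f p))
        = (cmod (opC lam \<alpha> f p))\<^sup>2 / (\<omega> (fst p) + \<omega> (snd p) + b - t)" for t
    proof -
      have "resC t f p * cnj (opC lam \<alpha> f p)
        = complex_of_real ((cmod (opC lam \<alpha> f p))\<^sup>2 / (\<omega> (fst p) + \<omega> (snd p) + b - t))"
        unfolding of_real_divide complex_norm_square by (simp add: resC_def)
      then show ?thesis by (metis Re_complex_of_real)
    qed
    show "Re (resC z f p * cnj (opC lam \<alpha> f p)) \<le> Re (resC z' f p * cnj (opC lam \<alpha> f p))"
      unfolding Re using lo[of "fst p"] lo[of "snd p"] z by (intro divide_left_mono) auto
  qed (use d2 in \<open>auto simp del: times_complex.sel\<close>)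
  also have "\<dots> = Re (LINT p|lborel. resC z' f p * cnj (opC lam \<alpha> f p))"
    using d2 by (simp del: times_complex.sel)
  finally show ?thesis using 1 by (simp add: form_def)
qed

text \<open>Of the two summands of \<open>C f\<close>, the one containing \<open>f k\<close> yields
  a multiple of \<open>f k\<close> and completes \<open>a + \<omega> k - z\<close> to
  \<open>phi (z - \<omega> k)\<close>; the one containing \<open>f q\<close> yields the integral
  operator.\<close>

lemma S_eq:
  assumes z: "gap z s" and f: "f \<in> L2"
  shows "S z f k = complex_of_real (phi (z - \<omega> k)) * f k
    - complex_of_real (\<alpha>\<^sup>2) * cnj (lam k) * pot z f k"
proof -
  note [measurable] = L2_D(1)[OF f]
  have i: "integrable lborel (\<lambda>q. u q * v q / complex_of_real (\<omega> k + \<omega> q + b - z))"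
    if "u \<in> L2" "v \<in> L2" for u v
    using L2_mult_integrable(2)[OF L2_mult_bounded[OF that(1) _ inverse_gap_bound[OF z]] that(2)]
    by (simp add: mult_ac)
  have eq: "resC z f (k, q) * lam q = complex_of_real \<alpha> * cnj (lam k) * (lam q * f q / complex_of_real (\<omega> k + \<omega> q + b - z))
     + complex_of_real \<alpha> * f k * (lam q * cnj (lam q) / complex_of_real (\<omega> k + \<omega> q + b - z))" for q
    by (simp add: resC_def opC_def add_divide_distrib algebra_simps)
  have "(LINT q|lborel. resC z f (k, q) * lam q) = complex_of_real \<alpha> * cnj (lam k) * pot z f k
    + complex_of_real \<alpha> * f k * (LINT q|lborel. lam q * cnj (lam q) / complex_of_real (\<omega> k + \<omega> q + b - z))"
    unfolding eq pot_def
    by (subst Bochner_Integration.integral_add)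
      (intro integrable_mult_right i lam f L2_cnj, intro integrable_mult_right i lam f L2_cnj,
        simp only: integral_mult_right_zero)
  also have "(LINT q|lborel. lam q * cnj (lam q) / complex_of_real (\<omega> k + \<omega> q + b - z))
    = (LINT q|lborel. complex_of_real ((cmod (lam q))\<^sup>2 / (\<omega> q + b - (z - \<omega> k))))"
    unfolding of_real_divide complex_norm_square by (simp add: algebra_simps)
  also have "\<dots> = complex_of_real (LINT q|lborel. (cmod (lam q))\<^sup>2 / (\<omega> q + b - (z - \<omega> k)))"
    by (simp only: integral_complex_of_real)
  finally show ?thesis
    by (simp add: S_def opB_def phi_def power2_eq_square algebra_simps)
qed

text \<open>The linear term accounts for the drop \<open>z' - z\<close>; the integral increases with
  \<open>z\<close> as its denominators are positive and shrink.\<close>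

lemma phi_decreasing:
  assumes "z \<le> z'" "z' < lo + b"
  shows "phi z' \<le> phi z - (z' - z)"
proof -
  have i: "integrable lborel (\<lambda>q. (cmod (lam q))\<^sup>2 / (\<omega> q + b - t))" if "t < lo + b" for t
  proof (rule Bochner_Integration.integrable_bound)
    show "integrable lborel (\<lambda>q. (cmod (lam q))\<^sup>2 / (lo + b - t))"
      using lam_nsq_integrable by simp
    show "AE q in lborel. norm ((cmod (lam q))\<^sup>2 / (\<omega> q + b - t)) \<le> norm ((cmod (lam q))\<^sup>2 / (lo + b - t))"
    proof (rule AE_I2)
      fix q show "norm ((cmod (lam q))\<^sup>2 / (\<omega> q + b - t)) \<le> norm ((cmod (lam q))\<^sup>2 / (lo + b - t))"
        using that lo[of q] by (auto simp: abs_of_pos intro!: divide_left_mono)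
    qed
  qed measurable
  have "(LINT q|lborel. (cmod (lam q))\<^sup>2 / (\<omega> q + b - z)) \<le> (LINT q|lborel. (cmod (lam q))\<^sup>2 / (\<omega> q + b - z'))"
  proof (rule integral_mono)
    fix q show "(cmod (lam q))\<^sup>2 / (\<omega> q + b - z) \<le> (cmod (lam q))\<^sup>2 / (\<omega> q + b - z')"
      using assms lo[of q] by (intro divide_left_mono) auto
  qed (use assms i in auto)
  then have "\<alpha>\<^sup>2 * (LINT q|lborel. (cmod (lam q))\<^sup>2 / (\<omega> q + b - z))
    \<le> \<alpha>\<^sup>2 * (LINT q|lborel. (cmod (lam q))\<^sup>2 / (\<omega> q + b - z'))"
    by (intro mult_left_mono) auto
  then show ?thesis by (simp add: phi_def)
qed

end

section \<open>Separable expansion of the kernel\<close>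

text \<open>Since \<open>(s + x) (s + y) - x y = s (s + x + y)\<close>, the kernel is the sum of a geometric series
  with ratio \<open>x y / ((s + x) (s + y))\<close>, all of whose terms are products of a function of \<open>x\<close> and
  the same function of \<open>y\<close>.\<close>

lemma kernel_expansion:
  fixes s x y :: real
  assumes "s > 0" "x \<ge> 0" "y \<ge> 0"
  shows "1 / (s + x + y) = (\<Sum>j<N. s * ((x / (s + x)) ^ j / (s + x)) * ((y / (s + y)) ^ j / (s + y)))
    + (x / (s + x)) ^ N * ((y / (s + y)) ^ N / (s + x + y))"
proof (induction N)
  case (Suc N)
  have "1 / (s + x + y) = s / ((s + x) * (s + y)) + (x / (s + x)) * (y / (s + y)) / (s + x + y)"
    using assms by (simp add: divide_simps) (simp add: algebra_simps)
  \<comment> \<open>Multiplying the identity for one step by \<open>A ^ N * B ^ N\<close> splits the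
    next term off the remainder.\<close>
  moreover have "A ^ N * (B ^ N / D) = s * (A ^ N / u) * (B ^ N / v) + A ^ Suc N * (B ^ Suc N / D)"
    if "1 / D = s / (u * v) + A * B / D" for A B D u v :: real
    using arg_cong[OF that, of "\<lambda>t. A ^ N * B ^ N * t"] by (simp add: algebra_simps)
  ultimately have "(x / (s + x)) ^ N * ((y / (s + y)) ^ N / (s + x + y))
    = s * ((x / (s + x)) ^ N / (s + x)) * ((y / (s + y)) ^ N / (s + y))
      + (x / (s + x)) ^ Suc N * ((y / (s + y)) ^ Suc N / (s + x + y))"
    by blast
  with Suc show ?case by simp
qed auto

context schur
begin

text \<open>The ratio \<open>x / (s + x)\<close> of the expansion at
  \<open>x = \<omega> k - lo\<close> and \<open>s = 2 * lo + b - z\<close>. It vanishes where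
  \<open>\<omega>\<close> takes the value \<open>lo\<close>.\<close>

definition rho :: "real \<Rightarrow> 'a \<Rightarrow> real" where
  "rho z k = (\<omega> k - lo) / (\<omega> k + lo + b - z)"

text \<open>The linear functionals through which the separable terms of the expansion act on
  \<open>f\<close>. Vanishing of the first \<open>N\<close> of them removes the finite-rank
  part.\<close>

definition ell :: "real \<Rightarrow> nat \<Rightarrow> ('a \<Rightarrow> complex) \<Rightarrow> complex" where
  "ell z j f = (LINT q|lborel. complex_of_real (rho z q ^ j / (\<omega> q + lo + b - z)) * (lam q * f q))"

lemma rho_meas [measurable]: "rho z \<in> borel_measurable borel"
  unfolding rho_def by measurable

text \<open>Since \<open>x / (s + x)\<close> increases in \<open>x\<close>, its value at
  \<open>hi - lo\<close> bounds it and gives uniform geometric decay. The bound by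
  \<open>x / s\<close> records the rate at which it vanishes at
  \<open>\<omega> = lo\<close>.\<close>

lemma rho_bounds:
  assumes "z < 2 * lo + b"
  shows "0 \<le> rho z k" "rho z k \<le> (hi - lo) / (hi + lo + b - z)" "rho z k \<le> 1"
    "rho z k \<le> (\<omega> k - lo) / (2 * lo + b - z)"
proof -
  show "0 \<le> rho z k" "rho z k \<le> 1" "rho z k \<le> (\<omega> k - lo) / (2 * lo + b - z)"
    using assms lo[of k] by (auto simp: rho_def intro!: divide_left_mono)
  have "(\<omega> k - lo) * (hi + lo + b - z) \<le> (hi - lo) * (\<omega> k + lo + b - z)"
    using mult_right_mono[OF hi[of k], of "2 * lo + b - z"] assms by (simp add: algebra_simps)
  then show "rho z k \<le> (hi - lo) / (hi + lo + b - z)"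
    using assms lo[of k] hi[of k] by (simp add: rho_def divide_simps)
qed

lemma kernel_expansion_rho:
  assumes "z < 2 * lo + b"
  shows "1 / (\<omega> k + \<omega> q + b - z)
    = (\<Sum>j<N. (2 * lo + b - z) * (rho z k ^ j / (\<omega> k + lo + b - z)) * (rho z q ^ j / (\<omega> q + lo + b - z)))
      + rho z k ^ N * (rho z q ^ N / (\<omega> k + \<omega> q + b - z))"
proof -
  have e: "2 * lo + b - z + (\<omega> k - lo) = \<omega> k + lo + b - z" for k by simp
  have e2: "\<omega> k + lo + b - z + (\<omega> q - lo) = \<omega> k + \<omega> q + b - z" by simp
  show ?thesis
    using kernel_expansion[of "2 * lo + b - z" "\<omega> k - lo" "\<omega> q - lo" N] assms lo[of k] lo[of q]
    unfolding e e2 rho_def by simp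
qed

section \<open>The integral operator and its quadratic form\<close>

lemma lam_mult_integrable:
  assumes f: "f \<in> L2"
    and h: "h \<in> borel_measurable borel" "\<And>k. cmod (h k) \<le> K"
  shows "integrable lborel (\<lambda>k. h k * (lam k * f k))"
  using L2_mult_integrable(2)[OF lam L2_mult_bounded[OF f h]] by (simp add: mult_ac)

lemma pot_meas:
  assumes "f \<in> L2"
  shows "pot z f \<in> borel_measurable borel"
proof -
  note [measurable] = L2_D(1)[OF assms]
  have "(\<lambda>k. pot z f k) \<in> borel_measurable lborel" unfolding pot_def by measurable
  then show ?thesis by simp
qed

lemma pot_bound:
  assumes z: "gap z s" and f: "f \<in> L2"
  shows "cmod (pot z f k) \<le> (LINT q|lborel. cmod (lam q) * cmod (f q)) / s"
proof -
  have "cmod (pot z f k) \<le> (LINT q|lborel. cmod (lam q * f q / complex_of_real (\<omega> k + \<omega> q + b - z)))"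
    unfolding pot_def by (rule integral_norm_bound)
  also have "\<dots> \<le> (LINT q|lborel. cmod (lam q) * cmod (f q) / s)"
  proof (rule integral_mono')
    fix q show "cmod (lam q * f q / complex_of_real (\<omega> k + \<omega> q + b - z)) \<le> cmod (lam q) * cmod (f q) / s"
      using mult_left_mono[OF inverse_gap_bound[OF z, of k q], of "cmod (lam q) * cmod (f q)"]
      by (simp add: norm_mult norm_divide)
  qed (use L2_mult_integrable(1)[OF lam f] z in \<open>auto simp: gap_def\<close>)
  finally show ?thesis by simp
qed

lemma pot_integrable:
  assumes z: "gap z s" and f: "f \<in> L2"
  shows "integrable lborel (\<lambda>k. cnj (lam k * f k) * pot z f k)"
proof -
  have "(\<lambda>k. pot z f k * cnj (f k)) \<in> L2"
    by (rule L2_mult_bounded[OF L2_cnj[OF f] pot_meas[OF f] pot_bound[OF z f]])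
  from L2_mult_integrable(2)[OF L2_cnj[OF lam] this] show ?thesis
    by (simp add: mult_ac)
qed

lemma Re_form:
  assumes z: "gap z s" and f: "f \<in> L2"
  shows "integrable lborel (\<lambda>k. phi (z - \<omega> k) * (cmod (f k))\<^sup>2)"
    "Re (form z f f) = (LINT k|lborel. phi (z - \<omega> k) * (cmod (f k))\<^sup>2)
      - \<alpha>\<^sup>2 * Re (LINT k|lborel. cnj (lam k * f k) * pot z f k)"
proof -
  have eq: "complex_of_real (phi (z - \<omega> k) * (cmod (f k))\<^sup>2)
    = S z f k * cnj (f k) + complex_of_real (\<alpha>\<^sup>2) * (cnj (lam k * f k) * pot z f k)" for k
    unfolding S_eq[OF z f] of_real_mult complex_norm_square by (simp add: algebra_simps)
  have i: "integrable lborel (\<lambda>k. complex_of_real (phi (z - \<omega> k) * (cmod (f k))\<^sup>2))"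
    unfolding eq by (intro Bochner_Integration.integrable_add integrable_mult_right pot_integrable[OF z f] form_eq[OF z f f])
  then show "integrable lborel (\<lambda>k. phi (z - \<omega> k) * (cmod (f k))\<^sup>2)"
    by (simp only: complex_of_real_integrable_eq)
  have "complex_of_real (LINT k|lborel. phi (z - \<omega> k) * (cmod (f k))\<^sup>2)
     = form z f f + complex_of_real (\<alpha>\<^sup>2) * (LINT k|lborel. cnj (lam k * f k) * pot z f k)"
    unfolding integral_complex_of_real[symmetric] eq form_eq(2)[OF z f f]
    by (subst Bochner_Integration.integral_add)
      (intro integrable_mult_right pot_integrable[OF z f] form_eq[OF z f f],
        intro integrable_mult_right pot_integrable[OF z f], simp only: integral_mult_right_zero)
  from arg_cong[OF this, of Re] show "Re (form z f f) = (LINT k|lborel. phi (z - \<omega> k) * (cmod (f k))\<^sup>2)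
      - \<alpha>\<^sup>2 * Re (LINT k|lborel. cnj (lam k * f k) * pot z f k)"
    by simp
qed

text \<open>Each separable term contributes a nonnegative square. The remainder carries
  \<open>rho ^ N\<close> in both variables; absorbing this factor into \<open>f\<close> gives the
  quadratic form of the same kernel at \<open>g\<close>, and that kernel is at most
  \<open>1 / (2 * lo + b - z)\<close>.\<close>

lemma pot_quadratic_expansion:
  assumes z: "z < 2 * lo + b" and f: "f \<in> L2"
  shows "\<bar>Re (LINT k|lborel. cnj (lam k * f k) * pot z f k)
      - (\<Sum>j<N. (2 * lo + b - z) * (cmod (ell z j f))\<^sup>2)\<bar>
    \<le> (LINT q|lborel. cmod (lam q) * (rho z q ^ N * cmod (f q)))\<^sup>2 / (2 * lo + b - z)"
proof -
  define s where "s = 2 * lo + b - z"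
  have gap: "gap z s" using gap_below[OF z] by (simp add: s_def)
  have s: "s > 0" using z by (simp add: s_def)
  define p where "p = (\<lambda>j k. rho z k ^ j / (\<omega> k + lo + b - z))"
  define g where "g = (\<lambda>q. complex_of_real (rho z q ^ N) * f q)"
  note [measurable] = L2_D(1)[OF f]
  have pm [measurable]: "p j \<in> borel_measurable borel" for j unfolding p_def by measurable
  have rho1: "rho z k ^ j \<le> 1" "0 \<le> rho z k ^ j" for j k
    using rho_bounds[OF z, of k] by (auto intro: power_le_one)
  have pb: "cmod (complex_of_real (p j k)) \<le> 1 / s" for j k
    unfolding p_def norm_of_real abs_divide using rho1[of k j] lo[of k] s
    by (intro frac_le) (auto simp: s_def)
  have gL2: "g \<in> L2"
    unfolding g_def by (rule L2_mult_bounded[OF f, where K=1])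
      (use rho1[of _ N] in \<open>auto simp: abs_of_nonneg simp flip: of_real_power\<close>)
  have pint: "integrable lborel (\<lambda>q. complex_of_real (p j q) * (lam q * f q))" for j
    by (rule lam_mult_integrable[OF f _ pb]) measurable
  have kint: "integrable lborel (\<lambda>q. lam q * g q / complex_of_real (\<omega> k + \<omega> q + b - z))" for k
    using lam_mult_integrable[OF gL2 _ inverse_gap_bound[OF gap]] by (simp add: mult_ac)
  have kernel: "lam q * f q / complex_of_real (\<omega> k + \<omega> q + b - z)
    = (\<Sum>j<N. complex_of_real (s * p j k) * (complex_of_real (p j q) * (lam q * f q)))
      + complex_of_real (rho z k ^ N) * (lam q * g q / complex_of_real (\<omega> k + \<omega> q + b - z))" for k q
  proof -
    have "lam q * f q / complex_of_real (\<omega> k + \<omega> q + b - z)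
       = complex_of_real (1 / (\<omega> k + \<omega> q + b - z)) * (lam q * f q)"
      by simp
    also have "1 / (\<omega> k + \<omega> q + b - z) = (\<Sum>j<N. s * p j k * p j q)
        + rho z k ^ N * (rho z q ^ N / (\<omega> k + \<omega> q + b - z))"
      unfolding s_def p_def by (rule kernel_expansion_rho[OF z])
    finally show ?thesis
      by (simp add: g_def algebra_simps sum_distrib_left sum_distrib_right)
  qed
  have pot: "pot z f k = (\<Sum>j<N. complex_of_real (s * p j k) * ell z j f)
     + complex_of_real (rho z k ^ N) * pot z g k" for k
  proof -
    have "pot z f k = (LINT q|lborel. (\<Sum>j<N. complex_of_real (s * p j k) * (complex_of_real (p j q) * (lam q * f q)))
      + complex_of_real (rho z k ^ N) * (lam q * g q / complex_of_real (\<omega> k + \<omega> q + b - z)))"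
      unfolding pot_def kernel ..
    also have "\<dots> = (LINT q|lborel. (\<Sum>j<N. complex_of_real (s * p j k) * (complex_of_real (p j q) * (lam q * f q))))
      + (LINT q|lborel. complex_of_real (rho z k ^ N) * (lam q * g q / complex_of_real (\<omega> k + \<omega> q + b - z)))"
      by (intro Bochner_Integration.integral_add Bochner_Integration.integrable_sum integrable_mult_right pint kint)
    also have "(LINT q|lborel. (\<Sum>j<N. complex_of_real (s * p j k) * (complex_of_real (p j q) * (lam q * f q))))
      = (\<Sum>j<N. (LINT q|lborel. complex_of_real (s * p j k) * (complex_of_real (p j q) * (lam q * f q))))"
      by (intro Bochner_Integration.integral_sum integrable_mult_right pint)
    finally show ?thesis
      by (simp only: integral_mult_right_zero ell_def pot_def p_def)
  qed
  have cell: "(LINT k|lborel. cnj (complex_of_real (p j k) * (lam k * f k))) = cnj (ell z j f)" for j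
    by (simp only: Bochner_Integration.integral_cnj ell_def p_def)
  have eq: "cnj (lam k * f k) * pot z f k
    = (\<Sum>j<N. complex_of_real s * ell z j f * cnj (complex_of_real (p j k) * (lam k * f k)))
      + cnj (lam k * g k) * pot z g k" for k
    unfolding pot by (simp add: g_def sum_distrib_left algebra_simps)
  have "(LINT k|lborel. cnj (lam k * f k) * pot z f k)
    = (LINT k|lborel. (\<Sum>j<N. complex_of_real s * ell z j f * cnj (complex_of_real (p j k) * (lam k * f k))))
      + (LINT k|lborel. cnj (lam k * g k) * pot z g k)"
    unfolding eq
    by (intro Bochner_Integration.integral_add Bochner_Integration.integrable_sum integrable_mult_right
        pint pot_integrable[OF gap gL2] integrable_cnj)
  also have "(LINT k|lborel. (\<Sum>j<N. complex_of_real s * ell z j f * cnj (complex_of_real (p j k) * (lam k * f k))))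
    = (\<Sum>j<N. complex_of_real s * ell z j f * (LINT k|lborel. cnj (complex_of_real (p j k) * (lam k * f k))))"
    by (subst Bochner_Integration.integral_sum)
      (intro integrable_mult_right integrable_cnj pint, simp only: integral_mult_right_zero)
  also have "\<dots> = (\<Sum>j<N. complex_of_real (s * (cmod (ell z j f))\<^sup>2))"
    unfolding cell of_real_mult complex_norm_square by (simp add: mult_ac)
  finally have main: "(LINT k|lborel. cnj (lam k * f k) * pot z f k) = complex_of_real (\<Sum>j<N. s * (cmod (ell z j f))\<^sup>2)
      + (LINT k|lborel. cnj (lam k * g k) * pot z g k)"
    by simp
  define M where "M = (LINT q|lborel. cmod (lam q) * cmod (g q))"
  have "cmod (LINT k|lborel. cnj (lam k * g k) * pot z g k)
      \<le> (LINT k|lborel. cmod (cnj (lam k * g k) * pot z g k))"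
    by (rule integral_norm_bound)
  also have "\<dots> \<le> (LINT k|lborel. cmod (lam k) * cmod (g k) * (M / s))"
    unfolding M_def
  proof (rule integral_mono')
    fix k
    show "cmod (cnj (lam k * g k) * pot z g k)
      \<le> cmod (lam k) * cmod (g k) * ((LINT q|lborel. cmod (lam q) * cmod (g q)) / s)"
      unfolding norm_mult complex_mod_cnj by (intro mult_left_mono pot_bound[OF gap gL2]) auto
  qed (use L2_mult_integrable(1)[OF lam gL2] s in auto)
  also have "\<dots> = M * (M / s)" by (simp add: M_def)
  finally have "\<bar>Re (LINT k|lborel. cnj (lam k * g k) * pot z g k)\<bar> \<le> M\<^sup>2 / s"
    using abs_Re_le_cmod[of "LINT k|lborel. cnj (lam k * g k) * pot z g k"] by (simp add: power2_eq_square)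
  moreover have "M = (LINT q|lborel. cmod (lam q) * (rho z q ^ N * cmod (f q)))"
    unfolding M_def g_def norm_mult norm_of_real using rho1 by (simp add: abs_of_nonneg)
  ultimately show ?thesis unfolding main s_def by simp
qed

text \<open>The remainder of the expansion tends to zero, so the integral operator is positive.\<close>

lemma pot_quadratic_nonneg:
  assumes z: "z < 2 * lo + b" and f: "f \<in> L2"
  shows "Re (LINT k|lborel. cnj (lam k * f k) * pot z f k) \<ge> 0"
proof -
  define s where "s = 2 * lo + b - z"
  have s: "s > 0" using z by (simp add: s_def)
  \<comment> \<open>An upper bound of \<open>rho z\<close>, below 1 because
    \<open>2 * lo + b - z\<close> is positive.\<close>
  define r where "r = (hi - lo) / (hi + lo + b - z)"
  define M where "M = (LINT q|lborel. cmod (lam q) * cmod (f q))"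
  have r: "0 \<le> r" "r < 1"
    using z order.trans[OF lo hi] by (auto simp: r_def divide_simps)
  have lower: "Re (LINT k|lborel. cnj (lam k * f k) * pot z f k) \<ge> - ((r ^ N * M)\<^sup>2 / s)" for N
  proof -
    have "(LINT q|lborel. cmod (lam q) * (rho z q ^ N * cmod (f q))) \<le> (LINT q|lborel. r ^ N * (cmod (lam q) * cmod (f q)))"
    proof (rule integral_mono')
      fix q
      have "rho z q ^ N \<le> r ^ N"
        using rho_bounds[OF z, of q] by (intro power_mono) (auto simp: r_def)
      then have "rho z q ^ N * (cmod (lam q) * cmod (f q)) \<le> r ^ N * (cmod (lam q) * cmod (f q))"
        by (intro mult_right_mono) auto
      then show "cmod (lam q) * (rho z q ^ N * cmod (f q)) \<le> r ^ N * (cmod (lam q) * cmod (f q))"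
        by (simp add: mult_ac)
    qed (use L2_mult_integrable(1)[OF lam f] r in auto)
    then have "(LINT q|lborel. cmod (lam q) * (rho z q ^ N * cmod (f q))) \<le> r ^ N * M"
      by (simp add: M_def)
    then have "(LINT q|lborel. cmod (lam q) * (rho z q ^ N * cmod (f q)))\<^sup>2 / s \<le> (r ^ N * M)\<^sup>2 / s"
      using rho_bounds[OF z] s by (intro divide_right_mono power_mono integral_nonneg_AE AE_I2) auto
    moreover have "0 \<le> (\<Sum>j<N. s * (cmod (ell z j f))\<^sup>2)"
      using s by (intro sum_nonneg) auto
    ultimately show ?thesis
      using pot_quadratic_expansion[OF z f, of N] unfolding s_def by linarith
  qed
  have lim: "(\<lambda>N. r ^ N) \<longlonglongrightarrow> 0" using r by (intro LIMSEQ_realpow_zero)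
  have "(\<lambda>N. - ((r ^ N * M)\<^sup>2 / s)) \<longlonglongrightarrow> - ((0 * M)\<^sup>2 / s)"
    using s by (intro tendsto_minus tendsto_divide tendsto_power[OF tendsto_mult[OF lim]] tendsto_const) auto
  then have "- ((0 * M)\<^sup>2 / s) \<le> Re (LINT k|lborel. cnj (lam k * f k) * pot z f k)"
    by (rule LIMSEQ_le_const2) (use lower in auto)
  then show ?thesis by simp
qed

text \<open>Here \<open>z - \<omega> k\<close> exceeds \<open>E\<close> by at least
  \<open>z - hi - E\<close>, so the multiplier is at most \<open>- (z - hi - E) < 0\<close>.
  Subtracting a positive integral operator leaves a negative definite form, whereas the form
  vanishes on a kernel vector.\<close>

lemma kernel_trivial_above:
  assumes E: "E < lo + b" "phi E = 0" and z: "hi + E < z" "z < 2 * lo + b"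
    and f: "f \<in> L2" and ker: "AE k in lborel. S z f k = 0"
  shows "AE k in lborel. f k = 0"
proof -
  have gap: "gap z (2 * lo + b - z)" using z by (intro gap_below)
  \<comment> \<open>The vector \<open>f\<close> is viewed as the zero function plus a kernel
    vector.\<close>
  have "form z (\<lambda>k. 0 + 1 * f k) (\<lambda>k. 0 + 1 * f k) = form z (\<lambda>k. 0) (\<lambda>k. 0)"
    by (rule form_add_kernel[OF gap L2_zero f ker])
  then have "form z f f = 0"
    using form_ae_zero[OF gap L2_zero] by simp
  then have "0 \<le> (LINT k|lborel. phi (z - \<omega> k) * (cmod (f k))\<^sup>2)"
    using Re_form(2)[OF gap f] mult_nonneg_nonneg[OF zero_le_power2[of \<alpha>] pot_quadratic_nonneg[OF z(2) f]]
    by simp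
  also have "\<dots> \<le> (LINT k|lborel. - (z - hi - E) * (cmod (f k))\<^sup>2)"
  proof (rule integral_mono)
    fix k
    have "phi (z - \<omega> k) \<le> phi E - (z - \<omega> k - E)"
      using z lo[of k] hi[of k] by (intro phi_decreasing) auto
    then show "phi (z - \<omega> k) * (cmod (f k))\<^sup>2 \<le> - (z - hi - E) * (cmod (f k))\<^sup>2"
      using E hi[of k] by (intro mult_right_mono) auto
  qed (use Re_form(1)[OF gap f] L2_D(2)[OF f] in auto)
  also have "\<dots> = - (z - hi - E) * (LINT k|lborel. (cmod (f k))\<^sup>2)"
    by (rule integral_mult_right_zero)
  finally have "(LINT k|lborel. (cmod (f k))\<^sup>2) \<le> 0"
    using z by (simp add: zero_le_mult_iff)
  then have "(LINT k|lborel. (cmod (f k))\<^sup>2) = 0"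
    by (intro antisym) simp_all
  then have "AE k in lborel. (cmod (f k))\<^sup>2 = 0"
    using integral_nonneg_eq_0_iff_AE[OF L2_D(2)[OF f]] by simp
  then show ?thesis by simp
qed

text \<open>At the threshold the multiplier \<open>phi (z - \<omega> k)\<close> is bounded below only by \<open>\<omega> k - lo\<close>, which may vanish;
  the factor \<open>rho ^ (2 N)\<close> of the remainder vanishes there too, at least as fast.\<close>

lemma form_nonneg_at_threshold:
  assumes E: "E < lo + b" "phi E = 0"
  obtains N where "\<And>f. f \<in> L2 \<Longrightarrow> (\<And>j. j < N \<Longrightarrow> ell (lo + E) j f = 0) \<Longrightarrow> Re (form (lo + E) f f) \<ge> 0"
proof -
  define z where "z = lo + E"
  define s where "s = 2 * lo + b - z"
  define r where "r = (hi - lo) / (hi + lo + b - z)"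
  define L where "L = (LINT q|lborel. (cmod (lam q))\<^sup>2)"
  have z: "z < 2 * lo + b" using E by (simp add: z_def)
  have s: "s > 0" using z by (simp add: s_def)
  have gap: "gap z s" unfolding s_def using z by (intro gap_below)
  have r: "0 \<le> r" "r < 1"
    using z order.trans[OF lo hi] by (auto simp: r_def divide_simps)
  have lim: "(\<lambda>m. (r\<^sup>2) ^ m) \<longlonglongrightarrow> 0"
    using r by (intro LIMSEQ_realpow_zero) (auto simp: power_less_one_iff)
  have "(\<lambda>m. \<alpha>\<^sup>2 * (L * ((r\<^sup>2) ^ m / s)) / s) \<longlonglongrightarrow> \<alpha>\<^sup>2 * (L * (0 / s)) / s"
    using s by (intro tendsto_divide[OF tendsto_mult] tendsto_mult[OF _ tendsto_divide[OF lim]] tendsto_const) auto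
  then have "eventually (\<lambda>m. \<alpha>\<^sup>2 * (L * ((r\<^sup>2) ^ m / s)) / s < 1) sequentially"
    by (rule order_tendstoD) simp
  \<comment> \<open>With this \<open>m\<close> the remainder, multiplied by
    \<open>\<alpha>\<^sup>2\<close>, is at most the form \<open>J\<close> of the multiplier
    \<open>\<omega> - lo\<close>.\<close>
  then obtain m where m: "\<alpha>\<^sup>2 * (L * ((r\<^sup>2) ^ m / s)) / s < 1"
    by (auto simp: eventually_sequentially)
  have "Re (form z f f) \<ge> 0" if f: "f \<in> L2" and ell: "\<And>j. j < Suc m \<Longrightarrow> ell z j f = 0" for f
  proof -
    note [measurable] = L2_D(1)[OF f]
    define J where "J = (LINT k|lborel. (\<omega> k - lo) * (cmod (f k))\<^sup>2)"
    define g where "g = (\<lambda>q. complex_of_real (rho z q ^ Suc m) * f q)"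
    have rho1: "rho z k ^ j \<le> 1" "0 \<le> rho z k ^ j" for j k
      using rho_bounds[OF z, of k] by (auto intro: power_le_one)
    have gL2: "g \<in> L2"
      unfolding g_def by (rule L2_mult_bounded[OF f, where K=1])
        (use rho1[of _ "Suc m"] in \<open>auto simp: abs_of_nonneg simp del: power_Suc of_real_power\<close>)
    have cg: "cmod (g q) = rho z q ^ Suc m * cmod (f q)" for q
      unfolding g_def norm_mult norm_of_real using rho1[of q "Suc m"] by (simp add: abs_of_nonneg)
    have Ji: "integrable lborel (\<lambda>k. (\<omega> k - lo) * (cmod (f k))\<^sup>2)"
    proof (rule Bochner_Integration.integrable_bound)
      show "integrable lborel (\<lambda>k. (hi - lo) * (cmod (f k))\<^sup>2)" using L2_D(2)[OF f] by simp
      show "AE k in lborel. norm ((\<omega> k - lo) * (cmod (f k))\<^sup>2) \<le> norm ((hi - lo) * (cmod (f k))\<^sup>2)"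
      proof (rule AE_I2)
        fix k show "norm ((\<omega> k - lo) * (cmod (f k))\<^sup>2) \<le> norm ((hi - lo) * (cmod (f k))\<^sup>2)"
          using lo[of k] hi[of k] by (auto simp: abs_mult intro!: mult_right_mono)
      qed
    qed measurable
    have J0: "0 \<le> J" unfolding J_def using lo by (intro integral_nonneg_AE AE_I2) (auto simp: algebra_simps intro!: mult_right_mono)
    have "\<bar>Re (LINT k|lborel. cnj (lam k * f k) * pot z f k)\<bar>
       \<le> (LINT q|lborel. cmod (lam q) * (rho z q ^ Suc m * cmod (f q)))\<^sup>2 / s"
      using pot_quadratic_expansion[OF z f, of "Suc m"] ell by (simp add: s_def del: power_Suc)
    also have "\<dots> = (LINT q|lborel. cmod (lam q) * cmod (g q))\<^sup>2 / s" by (simp only: cg)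
    also have "\<dots> \<le> L * (LINT q|lborel. (cmod (g q))\<^sup>2) / s"
      unfolding L_def using s by (intro divide_right_mono L2_Cauchy_Schwarz lam gL2) auto
    also have "\<dots> \<le> L * ((r\<^sup>2) ^ m / s * J) / s"
    proof -
      have "(LINT q|lborel. (cmod (g q))\<^sup>2) \<le> (LINT q|lborel. (r\<^sup>2) ^ m / s * ((\<omega> q - lo) * (cmod (f q))\<^sup>2))"
      proof (rule integral_mono)
        fix q
        \<comment> \<open>The exponent \<open>Suc m\<close> leaves two spare factors
          \<open>rho\<close>: one is bounded by \<open>(\<omega> q - lo) / s\<close>, the other by
          1. The remaining \<open>2 * m\<close> factors are bounded by \<open>r\<close> and supply
          the smallness.\<close>
        have "(rho z q ^ Suc m)\<^sup>2 = (rho z q ^ m)\<^sup>2 * (rho z q * rho z q)"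
          by (simp add: power2_eq_square)
        also have "\<dots> \<le> (r ^ m)\<^sup>2 * ((\<omega> q - lo) / s * 1)"
          using rho_bounds[OF z, of q] s r lo[of q] unfolding s_def r_def
          by (intro mult_mono power_mono) auto
        also have "\<dots> = (r\<^sup>2) ^ m / s * (\<omega> q - lo)"
          by (simp add: power_mult[symmetric] mult.commute)
        finally show "(cmod (g q))\<^sup>2 \<le> (r\<^sup>2) ^ m / s * ((\<omega> q - lo) * (cmod (f q))\<^sup>2)"
          using mult_right_mono[OF _ zero_le_power2[of "cmod (f q)"]]
          unfolding cg power_mult_distrib mult.assoc[symmetric] by blast
      qed (use L2_D(2)[OF gL2] Ji in auto)
      also have "\<dots> = (r\<^sup>2) ^ m / s * J" by (simp add: J_def)
      finally show ?thesis using s by (intro divide_right_mono mult_left_mono) (auto simp: L_def)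
    qed
    finally have "\<alpha>\<^sup>2 * \<bar>Re (LINT k|lborel. cnj (lam k * f k) * pot z f k)\<bar> \<le> \<alpha>\<^sup>2 * (L * ((r\<^sup>2) ^ m / s * J) / s)"
      by (intro mult_left_mono) auto
    also have "\<dots> = (\<alpha>\<^sup>2 * (L * ((r\<^sup>2) ^ m / s)) / s) * J" by simp
    also have "\<dots> \<le> 1 * J" using m J0 by (intro mult_right_mono) auto
    finally have 1: "\<alpha>\<^sup>2 * Re (LINT k|lborel. cnj (lam k * f k) * pot z f k) \<le> J"
      using mult_left_mono[OF abs_ge_self, of "\<alpha>\<^sup>2" "Re (LINT k|lborel. cnj (lam k * f k) * pot z f k)"]
      by simp
    have "J \<le> (LINT k|lborel. phi (z - \<omega> k) * (cmod (f k))\<^sup>2)"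
      unfolding J_def
    proof (rule integral_mono)
      fix k
      \<comment> \<open>Since \<open>phi E = 0\<close> and \<open>phi\<close> falls at least at unit
        rate, \<open>phi (z - \<omega> k)\<close> is at least
        \<open>\<omega> k - lo\<close>.\<close>
      have "phi E \<le> phi (z - \<omega> k) - (E - (z - \<omega> k))"
        using E lo[of k] by (intro phi_decreasing) (auto simp: z_def)
      then show "(\<omega> k - lo) * (cmod (f k))\<^sup>2 \<le> phi (z - \<omega> k) * (cmod (f k))\<^sup>2"
        using E by (intro mult_right_mono) (auto simp: z_def)
    qed (use Ji Re_form(1)[OF gap f] in auto)
    then show ?thesis using 1 Re_form(2)[OF gap f] by simp
  qed
  then show ?thesis using that[of "Suc m"] unfolding z_def by blast
qed

end

section \<open>Counting eigenvalues\<close>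

text \<open>A homogeneous linear system with more unknowns than equations has a nonzero solution.
  The induction is Gaussian elimination: the last equation is solved for one unknown, which is then
  substituted into the others.\<close>

lemma nontrivial_combination:
  fixes m :: "nat \<Rightarrow> 'b \<Rightarrow> 'c::field"
  assumes "finite A" "N < card A"
  shows "\<exists>c. (\<exists>t\<in>A. c t \<noteq> 0) \<and> (\<forall>j<N. (\<Sum>t\<in>A. c t * m j t) = 0)"
  using assms
proof (induction N arbitrary: A m)
  case 0
  then show ?case by (intro exI[of _ "\<lambda>_. 1"]) (auto simp: card_gt_0_iff)
next
  case (Suc N)
  show ?case
  proof (cases "\<forall>t\<in>A. m N t = 0")
    case True
    obtain c where "\<exists>t\<in>A. c t \<noteq> 0" "\<forall>j<N. (\<Sum>t\<in>A. c t * m j t) = 0"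
      using Suc.IH[OF Suc.prems(1), of m] Suc.prems(2) by auto
    with True show ?thesis by (intro exI[of _ c]) (auto simp: less_Suc_eq)
  next
    case False
    then obtain t0 where t0: "t0 \<in> A" "m N t0 \<noteq> 0" by auto
    define A' where "A' = A - {t0}"
    have A': "finite A'" "t0 \<notin> A'" "A = insert t0 A'" "N < card A'"
      using t0 Suc.prems by (auto simp: A'_def)
    obtain c where c: "\<exists>t\<in>A'. c t \<noteq> 0"
      "\<And>j. j < N \<Longrightarrow> (\<Sum>t\<in>A'. c t * (m j t - m N t / m N t0 * m j t0)) = 0"
      using Suc.IH[OF A'(1,4), of "\<lambda>j t. m j t - m N t / m N t0 * m j t0"] by auto
    \<comment> \<open>The value of the eliminated unknown that satisfies equation
      \<open>N\<close>.\<close>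
    define c0 where "c0 = - (\<Sum>t\<in>A'. c t * m N t) / m N t0"
    have split: "(\<Sum>t\<in>A. (c(t0 := c0)) t * m j t) = c0 * m j t0 + (\<Sum>t\<in>A'. c t * m j t)" for j
    proof -
      have "(\<Sum>t\<in>A'. (c(t0 := c0)) t * m j t) = (\<Sum>t\<in>A'. c t * m j t)"
        using A'(2) by (intro sum.cong) auto
      then show ?thesis using A'(1,2) by (simp add: A'(3))
    qed
    have "(\<Sum>t\<in>A. (c(t0 := c0)) t * m j t) = 0" if "j < Suc N" for j
    proof (cases "j = N")
      case True
      then show ?thesis using t0 by (simp only: split) (simp add: c0_def)
    next
      case False
      then have "(\<Sum>t\<in>A'. c t * m j t) - (\<Sum>t\<in>A'. c t * m N t) / m N t0 * m j t0 = 0"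
        using c(2)[of j] that
        by (simp add: right_diff_distrib sum_subtractf sum_divide_distrib sum_distrib_left sum_distrib_right mult_ac)
      then show ?thesis by (simp only: split) (simp add: c0_def)
    qed
    moreover have "\<exists>t\<in>A. (c(t0 := c0)) t \<noteq> 0"
      using c(1) A' by auto
    ultimately show ?thesis by (intro exI[of _ "c(t0 := c0)"]) auto
  qed
qed

context schur
begin

text \<open>Adding the kernel vector at a new point \<open>t\<close> does not change the form at \<open>t\<close>, and the form
  decreases strictly to the right of \<open>t\<close>.\<close>

lemma form_negative_on_span:
  fixes A :: "real set" and f :: "real \<Rightarrow> 'a \<Rightarrow> complex"
  assumes "finite A" and "\<And>t. t \<in> A \<Longrightarrow> f t \<in> L2"
    and "\<And>t. t \<in> A \<Longrightarrow> \<not> (AE k in lborel. f t k = 0)"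
    and "\<And>t. t \<in> A \<Longrightarrow> AE k in lborel. S t (f t) k = 0"
    and "\<exists>t\<in>A. c t \<noteq> 0" and "\<And>t. t \<in> A \<Longrightarrow> t < z" and "z < 2 * lo + b"
  shows "Re (form z (\<lambda>k. \<Sum>t\<in>A. c t * f t k) (\<lambda>k. \<Sum>t\<in>A. c t * f t k)) < 0"
  using assms
\<comment> \<open>Points are added in increasing order. The new point \<open>t\<close> exceeds all
  earlier ones, so the induction hypothesis can be used with \<open>z\<close> replaced by
  \<open>t\<close>.\<close>
proof (induction A arbitrary: z rule: finite_linorder_max_induct)
  case empty
  then show ?case by simp
next
  case (insert t A)
  define v where "v = (\<lambda>k. \<Sum>t\<in>A. c t * f t k)"
  define u where "u = (\<lambda>k. v k + c t * f t k)"
  have "t \<notin> A" using insert.hyps by blast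
  then have u: "(\<lambda>k. \<Sum>t\<in>insert t A. c t * f t k) = u"
    using insert.hyps(1) by (simp add: u_def v_def add.commute)
  have ft: "f t \<in> L2" "\<not> (AE k in lborel. f t k = 0)" "AE k in lborel. S t (f t) k = 0"
    using insert.prems by auto
  have t: "t < z" "t < 2 * lo + b" using insert.prems by force+
  have v2: "v \<in> L2" unfolding v_def using insert.hyps(1) insert.prems(1) by (intro L2_sum) auto
  have u2: "u \<in> L2" unfolding u_def by (intro L2_add L2_scale ft v2)
  note gap = gap_below[OF t(2)]
  have uv: "form t u u = form t v v"
    unfolding u_def by (rule form_add_kernel[OF gap v2 ft(1,3)])
  have v_neg: "Re (form t v v) < 0" if "\<exists>t\<in>A. c t \<noteq> 0"
    unfolding v_def by (rule insert.IH) (use insert.prems insert.hyps that t in auto)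
  have v_zero: "v = (\<lambda>k. 0)" if "\<not> (\<exists>t\<in>A. c t \<noteq> 0)"
    using that by (auto simp: v_def)
  have v_le: "Re (form t v v) \<le> 0"
    using v_neg v_zero form_ae_zero[OF gap L2_zero] by fastforce
  \<comment> \<open>Strict decrease of the form to the right of \<open>t\<close> requires
    \<open>u\<close> to be nonzero. If \<open>u\<close> vanished, so would the form of
    \<open>v\<close> at \<open>t\<close>; then all earlier coefficients are zero and
    \<open>u\<close> is a nonzero multiple of \<open>f t\<close>.\<close>
  have "\<not> (AE k in lborel. u k = 0)"
  proof
    assume *: "AE k in lborel. u k = 0"
    then have "form t v v = 0" using form_ae_zero[OF gap u2] uv by simp
    then have c0: "\<not> (\<exists>t\<in>A. c t \<noteq> 0)" using v_neg by auto
    then have "c t \<noteq> 0" using insert.prems by auto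
    then show False using * ft(2) v_zero[OF c0] by (simp add: u_def)
  qed
  then have "(LINT k|lborel. (cmod (u k))\<^sup>2) \<noteq> 0"
    using integral_nonneg_eq_0_iff_AE[OF L2_D(2)[OF u2]] by simp
  moreover have "(LINT k|lborel. (cmod (u k))\<^sup>2) \<ge> 0" by simp
  ultimately have "(LINT k|lborel. (cmod (u k))\<^sup>2) > 0" by linarith
  then have "(z - t) * (LINT k|lborel. (cmod (u k))\<^sup>2) > 0"
    using t by (intro mult_pos_pos) auto
  then show ?case
    using form_antimono[OF u2, of t z] t insert.prems(6) uv v_le unfolding u by auto
qed

text \<open>Among \<open>N + 1\<close> kernel vectors at distinct points some nontrivial combination
  is annihilated by the \<open>N\<close> functionals \<open>ell\<close>. At \<open>lo + E\<close>
  its form is nonnegative by the expansion and negative by monotonicity.\<close>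

lemma finitely_many_kernels_below:
  assumes E: "E < lo + b" "phi E = 0" and X: "\<And>t. t \<in> X \<Longrightarrow> t < lo + E"
    and ker: "\<And>t. t \<in> X \<Longrightarrow> \<exists>f\<in>L2. \<not> (AE k in lborel. f k = 0) \<and> (AE k in lborel. S t f k = 0)"
  shows "finite X"
proof (rule ccontr)
  assume inf: "infinite X"
  obtain N where N: "\<And>f. f \<in> L2 \<Longrightarrow> (\<And>j. j < N \<Longrightarrow> ell (lo + E) j f = 0) \<Longrightarrow> Re (form (lo + E) f f) \<ge> 0"
    using form_nonneg_at_threshold[OF E] by blast
  obtain A where A: "finite A" "card A = Suc N" "A \<subseteq> X"
    using infinite_arbitrarily_large[OF inf] by blast
  obtain f where f: "\<And>t. t \<in> X \<Longrightarrow> f t \<in> L2" "\<And>t. t \<in> X \<Longrightarrow> \<not> (AE k in lborel. f t k = 0)"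
    "\<And>t. t \<in> X \<Longrightarrow> AE k in lborel. S t (f t) k = 0"
    using ker by metis
  obtain c where c: "\<exists>t\<in>A. c t \<noteq> 0" "\<And>j. j < N \<Longrightarrow> (\<Sum>t\<in>A. c t * ell (lo + E) j (f t)) = 0"
    using nontrivial_combination[of A N "\<lambda>j t. ell (lo + E) j (f t)"] A by auto
  define u where "u = (\<lambda>k. \<Sum>t\<in>A. c t * f t k)"
  have z: "lo + E < 2 * lo + b" using E by simp
  have u2: "u \<in> L2" unfolding u_def using A f(1) by (intro L2_sum) auto
  have "ell (lo + E) j u = (\<Sum>t\<in>A. c t * ell (lo + E) j (f t))" for j
  proof -
    define p where "p = (\<lambda>q. complex_of_real (rho (lo + E) q ^ j / (\<omega> q + lo + b - (lo + E))))"
    have i: "integrable lborel (\<lambda>q. p q * (lam q * f t q))" if "t \<in> A" for t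
    proof (rule lam_mult_integrable)
      show "f t \<in> L2" using that A f by auto
      show "p \<in> borel_measurable borel" unfolding p_def by measurable
      fix q
      show "cmod (p q) \<le> 1 / (lo + b - E)"
        unfolding p_def norm_of_real abs_divide using rho_bounds[OF z, of q] lo[of q] E
        by (intro frac_le) (auto simp: power_le_one)
    qed
    have ell: "ell (lo + E) j h = (LINT q|lborel. p q * (lam q * h q))" for h
      by (simp only: ell_def p_def)
    have "ell (lo + E) j u = (LINT q|lborel. (\<Sum>t\<in>A. c t * (p q * (lam q * f t q))))"
      unfolding ell u_def by (intro Bochner_Integration.integral_cong refl) (simp add: sum_distrib_left mult_ac)
    also have "\<dots> = (\<Sum>t\<in>A. c t * (LINT q|lborel. p q * (lam q * f t q)))"
      using i by (subst Bochner_Integration.integral_sum) auto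
    finally show ?thesis by (simp only: ell)
  qed
  then have "Re (form (lo + E) u u) \<ge> 0"
    using c(2) by (intro N u2) simp
  moreover have "Re (form (lo + E) u u) < 0"
    unfolding u_def by (rule form_negative_on_span) (use A f X c(1) z in auto)
  ultimately show False by simp
qed

text \<open>The set \<open>X\<close> stands for the discrete spectrum, or for its reflection.\<close>

lemma locally_finite_at_thresholds:
  assumes E: "E < lo + b" "phi E = 0" and "lo < hi"
    and X1: "\<And>t. t \<in> X \<Longrightarrow> \<not> (2 * lo + b < t \<and> t < 2 * hi + b)"
    and X2: "\<And>t. t \<in> X \<Longrightarrow> \<not> (lo + E < t \<and> t < hi + E)"
    and X3: "\<And>t. t \<in> X \<Longrightarrow> t < 2 * lo + b \<Longrightarrow>
      \<exists>f\<in>L2. \<not> (AE k in lborel. f k = 0) \<and> (AE k in lborel. S t f k = 0)"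
    and z: "z = lo + E \<or> z = hi + E"
  shows "\<exists>\<delta>>0. finite (X \<inter> ball z \<delta>)"
  using z
proof
  assume z: "z = lo + E"
  have "finite {t\<in>X. t < lo + E}"
    by (rule finitely_many_kernels_below[OF E]) (use X3 E in auto)
  \<comment> \<open>To the right of \<open>lo + E\<close> the ball stays inside the interval
    excluded by \<open>X2\<close>.\<close>
  moreover have "X \<inter> ball z (hi - lo) \<subseteq> insert z {t\<in>X. t < lo + E}"
    using X2 by (force simp: z dist_real_def)
  ultimately show ?thesis
    using \<open>lo < hi\<close> by (intro exI[of _ "hi - lo"]) (auto intro: finite_subset)
next
  assume z: "z = hi + E"
  show ?thesis
  proof (cases "hi + E < 2 * lo + b")
    case True
    have "t \<notin> X" if "hi + E < t" "t < 2 * lo + b" for t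
      using kernel_trivial_above[OF E that] X3[of t] that by blast
    then have "X \<inter> ball z (min (hi - lo) (2 * lo + b - z)) \<subseteq> {z}"
      using X2 by (force simp: z dist_real_def)
    then show ?thesis
      using True \<open>lo < hi\<close> by (intro exI[of _ "min (hi - lo) (2 * lo + b - z)"]) (auto intro: finite_subset simp: z)
  next
    case False
    \<comment> \<open>Now \<open>hi + E\<close> is at least \<open>2 * lo + b\<close>, and
      \<open>hi + b - E\<close> is its distance to \<open>2 * hi + b\<close>. Points of the ball to
      the right of \<open>z\<close> are therefore excluded by \<open>X1\<close>, those to the left
      by \<open>X2\<close>.\<close>
    then have "X \<inter> ball z (min (hi - lo) (hi + b - E)) \<subseteq> {z}"
      using X1 X2 by (force simp: z dist_real_def)
    then show ?thesis
      using E \<open>lo < hi\<close> by (intro exI[of _ "min (hi - lo) (hi + b - E)"]) (auto intro: finite_subset)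
  qed
qed

end

section \<open>Weyl sequences\<close>

lemma L2_inner_self: "L2_inner f f = complex_of_real (LINT x|lborel. (cmod (f x))\<^sup>2)"
  unfolding L2_inner_def integral_complex_of_real[symmetric] complex_norm_square ..

lemma hilb_norm_square:
  "(hilb_norm x)\<^sup>2 = (LINT k|lborel. (cmod (fst x k))\<^sup>2) + (LINT p|lborel. (cmod (snd x p))\<^sup>2) / 2"
  by (simp add: hilb_norm_def hilb_inner_def L2_inner_self)

lemma hilb_norm_cong:
  assumes "x \<in> hilb" "y \<in> hilb" "hilb_eq x y"
  shows "hilb_norm x = hilb_norm y"
proof -
  have m: "fst x \<in> borel_measurable borel" "fst y \<in> borel_measurable borel"
    "snd x \<in> borel_measurable borel" "snd y \<in> borel_measurable borel"
    using assms(1,2) by (auto simp: hilb_def L2s_def mem_Times_iff intro: L2_D)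
  have "(LINT k|lborel. (cmod (fst x k))\<^sup>2) = (LINT k|lborel. (cmod (fst y k))\<^sup>2)"
    "(LINT p|lborel. (cmod (snd x p))\<^sup>2) = (LINT p|lborel. (cmod (snd y p))\<^sup>2)"
    using m assms(3) by (auto simp: hilb_eq_def intro!: integral_cong_AE)
  then show ?thesis
    by (simp add: hilb_norm_def hilb_inner_def L2_inner_self)
qed

text \<open>The bounded inverse \<open>R\<close> recovers \<open>x\<close> from
  \<open>T x - scale z x\<close>, so approximate eigenvectors cannot exist at a point of the
  resolvent set.\<close>

lemma resolvent_bound:
  assumes "z \<in> resolvent_set T"
  obtains K where "K > 0" "\<And>x. x \<in> hilb \<Longrightarrow> T x - scale z x \<in> hilb \<Longrightarrow>
    (hilb_norm x)\<^sup>2 \<le> K * (hilb_norm (T x - scale z x))\<^sup>2"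
proof -
  obtain R where R: "bounded_operator R" "\<And>x. x \<in> hilb \<Longrightarrow> R (T x - scale z x) \<approx> x"
    using assms by (auto simp: resolvent_set_def)
  obtain K where K: "\<And>x. x \<in> hilb \<Longrightarrow> hilb_norm (R x) \<le> K * hilb_norm x"
    "\<And>x. x \<in> hilb \<Longrightarrow> R x \<in> hilb"
    using R(1) unfolding bounded_operator_def by blast
  show thesis
  \<comment> \<open>Adding 1 makes the constant positive whatever the sign of
    \<open>K\<close>.\<close>
  proof (rule that[of "K\<^sup>2 + 1"])
    fix x assume x: "x \<in> hilb" "T x - scale z x \<in> hilb"
    have nn: "0 \<le> hilb_norm y" for y :: "'a state"
      unfolding hilb_norm_def hilb_inner_def by (simp add: L2_inner_self)
    have "hilb_norm x = hilb_norm (R (T x - scale z x))"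
      using x K R by (intro hilb_norm_cong[symmetric]) auto
    also have "\<dots> \<le> K * hilb_norm (T x - scale z x)" using x K by auto
    finally have "(hilb_norm x)\<^sup>2 \<le> (K * hilb_norm (T x - scale z x))\<^sup>2"
      using nn by (intro power_mono)
    also have "\<dots> \<le> (K\<^sup>2 + 1) * (hilb_norm (T x - scale z x))\<^sup>2"
      by (simp add: power_mult_distrib mult_right_mono)
    finally show "(hilb_norm x)\<^sup>2 \<le> (K\<^sup>2 + 1) * (hilb_norm (T x - scale z x))\<^sup>2" .
  qed (auto simp: add_nonneg_pos)
qed

section \<open>Test functions on small balls\<close>

lemma concentrated_ball:
  fixes \<omega> :: "'a::euclidean_space \<Rightarrow> real" and lam :: "'a \<Rightarrow> complex"
  assumes cont: "continuous_on UNIV \<omega>" and lam: "lam \<in> L2" and "\<epsilon> > 0"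
  obtains d where "d > 0" "\<And>k. k \<in> ball k0 d \<Longrightarrow> \<bar>\<omega> k - \<omega> k0\<bar> < \<epsilon>"
    "(LINT q|lborel. (cmod (indicator (ball k0 d) q * lam q))\<^sup>2) < \<epsilon>"
proof -
  note [measurable] = L2_D(1)[OF lam]
  obtain e where e: "e > 0" "\<And>k. k \<in> ball k0 e \<Longrightarrow> \<bar>\<omega> k - \<omega> k0\<bar> < \<epsilon>"
    using cont \<open>\<epsilon> > 0\<close> unfolding continuous_on_iff by (metis UNIV_I dist_commute dist_real_def mem_ball)
  \<comment> \<open>The balls shrink to the null set \<open>{k0}\<close>, so dominated convergence
    makes the mass of \<open>lam\<close> on them small.\<close>
  have "(\<lambda>n. LINT q|lborel. (cmod (indicator (ball k0 (e / Suc n)) q * lam q))\<^sup>2) \<longlonglongrightarrow> (LINT q|(lborel::'a measure). 0)"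
  proof (rule integral_dominated_convergence)
    show "integrable lborel (\<lambda>q. (cmod (lam q))\<^sup>2)" using lam by (rule L2_D)
    have "AE q in lborel. q \<noteq> k0"
      using AE_lborel_singleton by blast
    then show "AE q in lborel. (\<lambda>n. (cmod (indicator (ball k0 (e / Suc n)) q * lam q))\<^sup>2) \<longlonglongrightarrow> 0"
    proof eventually_elim
      case (elim q)
      have "(\<lambda>n. e / Suc n) \<longlonglongrightarrow> 0" by real_asymp
      then have "eventually (\<lambda>n. e / Suc n < dist k0 q) sequentially"
        by (rule order_tendstoD) (use elim in auto)
      then have "eventually (\<lambda>n. (cmod (indicator (ball k0 (e / Suc n)) q * lam q))\<^sup>2 = 0) sequentially"
        by eventually_elim auto
      then show ?case by (rule tendsto_eventually)
    qed
  qed (auto simp: indicator_def)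
  then have "eventually (\<lambda>n. (LINT q|lborel. (cmod (indicator (ball k0 (e / Suc n)) q * lam q))\<^sup>2) < \<epsilon>) sequentially"
    by (rule order_tendstoD) (use \<open>\<epsilon> > 0\<close> in auto)
  then obtain n where n: "(LINT q|lborel. (cmod (indicator (ball k0 (e / Suc n)) q * lam q))\<^sup>2) < \<epsilon>"
    by (auto simp: eventually_sequentially)
  have "e / Suc n \<le> e" using e by (simp add: field_simps)
  then have "ball k0 (e / Suc n) \<subseteq> ball k0 e" by (rule subset_ball)
  then show thesis using e n by (intro that[of "e / Suc n"]) auto
qed

lemma ball_L2:
  fixes k0 :: "'a::euclidean_space"
  assumes "d > 0"
  shows "indicator (ball k0 d) \<in> L2"
    "(LINT k|lborel. (cmod (indicator (ball k0 d) k :: complex))\<^sup>2) = measure lborel (ball k0 d)"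
    "measure lborel (ball k0 d) > 0"
proof -
  have e: "(\<lambda>k. (cmod (indicator (ball k0 d) k :: complex))\<^sup>2) = indicator (ball k0 d)"
    by (auto simp: indicator_def)
  have fin: "emeasure lborel (ball k0 d) < \<infinity>" by (rule emeasure_bounded_finite) simp
  show "(indicator (ball k0 d) :: 'a \<Rightarrow> complex) \<in> L2"
  proof (rule L2_I)
    show "(indicator (ball k0 d) :: 'a \<Rightarrow> complex) \<in> borel_measurable borel"
      by (intro borel_measurable_indicator) auto
  qed (use fin in \<open>auto simp: e\<close>)
  show "(LINT k|lborel. (cmod (indicator (ball k0 d) k :: complex))\<^sup>2) = measure lborel (ball k0 d)"
    by (simp add: e)
  show "measure lborel (ball k0 d) > 0"
    using content_ball_pos[OF assms, of k0] by simp
qed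

text \<open>The indicator equals its own square; giving one copy to \<open>lam\<close> makes
  Cauchy-Schwarz see only the mass of \<open>lam\<close> inside the ball.\<close>

lemma lam_ball_Cauchy_Schwarz:
  fixes k0 :: "'a::euclidean_space"
  assumes "lam \<in> L2" "d > 0"
  shows "(LINT q|lborel. cmod (lam q) * cmod (indicator (ball k0 d) q :: complex))\<^sup>2
    \<le> (LINT q|lborel. (cmod (indicator (ball k0 d) q * lam q))\<^sup>2) * measure lborel (ball k0 d)"
proof -
  have L: "(\<lambda>q. indicator (ball k0 d) q * lam q) \<in> L2"
    by (rule L2_mult_bounded[OF assms(1), where K=1]) (auto simp: indicator_def)
  have "cmod (lam q) * cmod (indicator (ball k0 d) q :: complex)
      = cmod (indicator (ball k0 d) q * lam q) * cmod (indicator (ball k0 d) q :: complex)" for q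
    by (auto simp: indicator_def)
  then show ?thesis
    using L2_Cauchy_Schwarz[OF L ball_L2(1)[OF assms(2), of k0]] by (simp only: ball_L2(2)[OF assms(2)])
qed

text \<open>The Weyl sequence is \<open>(0, g)\<close> with \<open>g\<close> the indicator of \<open>B \<times> B\<close>, for balls \<open>B\<close> shrinking to \<open>k1\<close>.\<close>

lemma spectrum_two_particles:
  fixes \<omega> :: "'a::euclidean_space \<Rightarrow> real"
  assumes cont: "continuous_on UNIV \<omega>" and lam: "lam \<in> L2"
  shows "complex_of_real (2 * \<omega> k1 + \<gamma>) \<in> spectrum (op_matrix \<omega> lam \<gamma> \<alpha>)"
proof (rule ccontr)
  define z where "z = 2 * \<omega> k1 + \<gamma>"
  define T where "T = op_matrix \<omega> lam \<gamma> \<alpha>"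
  assume "complex_of_real (2 * \<omega> k1 + \<gamma>) \<notin> spectrum (op_matrix \<omega> lam \<gamma> \<alpha>)"
  then have "complex_of_real z \<in> resolvent_set T" by (simp add: spectrum_def z_def T_def)
  then obtain K where K: "K > 0" "\<And>x. x \<in> hilb \<Longrightarrow> T x - scale z x \<in> hilb \<Longrightarrow>
      (hilb_norm x)\<^sup>2 \<le> K * (hilb_norm (T x - scale z x))\<^sup>2"
    using resolvent_bound by blast
  \<comment> \<open>The residual will be at most
    \<open>(\<alpha>\<^sup>2 + 2) * \<epsilon> * v\<^sup>2\<close>, with
    \<open>\<alpha>\<^sup>2\<close> from the coupling and 2 from the variation of
    \<open>\<omega>\<close>. The choice of \<open>\<epsilon>\<close> below makes \<open>K\<close>
    times it at most \<open>v\<^sup>2 / 4\<close>.\<close>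
  define c where "c = K * (\<alpha>\<^sup>2 + 2)"
  have c: "c > 0" unfolding c_def using K(1) by (intro mult_pos_pos) (auto simp: add_nonneg_pos)
  define \<epsilon> where "\<epsilon> = min 1 (1 / (4 * c))"
  have "c * \<epsilon> \<le> c * (1 / (4 * c))" using c by (intro mult_left_mono) (auto simp: \<epsilon>_def)
  also have "\<dots> = 1 / 4" using c by simp
  finally have \<epsilon>: "\<epsilon> > 0" "\<epsilon> \<le> 1" "K * (\<alpha>\<^sup>2 + 2) * \<epsilon> \<le> 1 / 4"
    using c unfolding c_def[symmetric] by (auto simp: \<epsilon>_def)
  obtain d where d: "d > 0" "\<And>k. k \<in> ball k1 d \<Longrightarrow> \<bar>\<omega> k - \<omega> k1\<bar> < \<epsilon>"
    "(LINT q|lborel. (cmod (indicator (ball k1 d) q * lam q))\<^sup>2) < \<epsilon>"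
    using concentrated_ball[OF cont lam \<epsilon>(1)] by blast
  define B :: "'a \<Rightarrow> complex" where "B = indicator (ball k1 d)"
  define v where "v = measure lborel (ball k1 d)"
  have B: "B \<in> L2" "(LINT k|lborel. (cmod (B k))\<^sup>2) = v" "v > 0"
    using ball_L2[OF d(1), of k1] by (auto simp: B_def v_def)
  note [measurable] = L2_D(1)[OF B(1)] L2_D(1)[OF lam] borel_measurable_continuous_onI[OF cont]
  define g where "g = (\<lambda>p. B (fst p) * B (snd p))"
  define h where "h = (\<lambda>p. complex_of_real (\<omega> (fst p) + \<omega> (snd p) - 2 * \<omega> k1) * g p)"
  define I where "I = (LINT q|lborel. B q * lam q)"
  have g: "g \<in> L2" unfolding g_def by (rule L2_tensor[OF B(1) B(1)])
  have gn: "(LINT p|lborel. (cmod (g p))\<^sup>2) = v\<^sup>2"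
  proof -
    have i: "integrable (lborel \<Otimes>\<^sub>M lborel) (\<lambda>p. (cmod (g p))\<^sup>2)"
      using L2_D(2)[OF g] by (simp add: lborel_prod)
    have "(LINT p|lborel. (cmod (g p))\<^sup>2) = (LINT p|(lborel \<Otimes>\<^sub>M lborel). (cmod (g p))\<^sup>2)"
      by (simp add: lborel_prod)
    also have "\<dots> = (LINT k|lborel. LINT q|lborel. (cmod (g (k, q)))\<^sup>2)"
      using lborel_pair.integral_fst'[OF i] by simp
    also have "\<dots> = v\<^sup>2"
      by (simp add: g_def norm_mult power_mult_distrib B(2)) (simp add: B(2) power2_eq_square)
    finally show ?thesis .
  qed
  have hb: "cmod (h p) \<le> 2 * \<epsilon> * cmod (g p)" for p
  proof (cases "fst p \<in> ball k1 d \<and> snd p \<in> ball k1 d")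
    case True
    then have "\<bar>\<omega> (fst p) + \<omega> (snd p) - 2 * \<omega> k1\<bar> \<le> 2 * \<epsilon>"
      using d(2)[of "fst p"] d(2)[of "snd p"] by linarith
    then show ?thesis unfolding h_def norm_mult norm_of_real by (intro mult_right_mono) auto
  qed (auto simp: h_def g_def B_def)
  have hb2: "(cmod (h p))\<^sup>2 \<le> 4 * \<epsilon>\<^sup>2 * (cmod (g p))\<^sup>2" for p
    using power_mono[OF hb norm_ge_zero, of p 2] by (simp add: power_mult_distrib)
  have h: "h \<in> L2"
  proof (rule L2_I)
    show "h \<in> borel_measurable borel" unfolding h_def g_def by measurable
    then show "integrable lborel (\<lambda>p. (cmod (h p))\<^sup>2)"
      by (intro Bochner_Integration.integrable_bound[OF integrable_mult_right[OF L2_D(2)[OF g], of "4 * \<epsilon>\<^sup>2"]])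
        (use hb2 in auto)
  qed
  define x :: "'a state" where "x = (\<lambda>k. 0, g)"
  have Tx: "T x - scale z x = (\<lambda>k. complex_of_real \<alpha> * I * B k, h)"
    by (auto simp: T_def x_def op_matrix_def scale_def opA_def opB_def opC_def opD_def h_def g_def I_def z_def
        fun_eq_iff algebra_simps)
  have sym: "g (snd p, fst p) = g p" "h (snd p, fst p) = h p" for p
    by (simp_all add: g_def h_def algebra_simps)
  have x: "x \<in> hilb" "T x - scale z x \<in> hilb"
    using g h L2_scale[OF B(1), of "complex_of_real \<alpha> * I"] unfolding Tx
    by (auto simp: x_def hilb_def L2s_def sym intro: L2_zero)
  have "(cmod I)\<^sup>2 \<le> (LINT q|lborel. cmod (lam q) * cmod (B q))\<^sup>2"
    unfolding I_def using integral_norm_bound[of lborel "\<lambda>q. B q * lam q"]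
    by (intro power_mono) (simp_all add: norm_mult mult_ac)
  also have "\<dots> \<le> \<epsilon> * v"
    using lam_ball_Cauchy_Schwarz[OF lam d(1), of k1] d(3) B(3)
    unfolding B_def v_def by (smt (verit) mult_right_mono)
  finally have I: "(cmod I)\<^sup>2 \<le> \<epsilon> * v" .
  have "(LINT p|lborel. (cmod (h p))\<^sup>2) \<le> (LINT p|lborel. 4 * \<epsilon>\<^sup>2 * (cmod (g p))\<^sup>2)"
    using L2_D(2)[OF h] L2_D(2)[OF g] hb2 by (intro integral_mono) auto
  also have "\<dots> = 4 * \<epsilon>\<^sup>2 * v\<^sup>2" by (simp add: gn)
  also have "\<dots> \<le> 4 * \<epsilon> * v\<^sup>2"
    using \<epsilon> by (intro mult_right_mono mult_left_mono) (auto simp: power2_eq_square mult_left_le)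
  finally have hn: "(LINT p|lborel. (cmod (h p))\<^sup>2) \<le> 4 * \<epsilon> * v\<^sup>2" .
  have "(hilb_norm (T x - scale z x))\<^sup>2 = \<alpha>\<^sup>2 * (cmod I)\<^sup>2 * v + (LINT p|lborel. (cmod (h p))\<^sup>2) / 2"
    unfolding Tx hilb_norm_square by (simp add: norm_mult power_mult_distrib B(2))
  also have "\<dots> \<le> \<alpha>\<^sup>2 * (\<epsilon> * v) * v + 4 * \<epsilon> * v\<^sup>2 / 2"
    using I hn B(3) by (intro add_mono mult_left_mono mult_right_mono divide_right_mono) auto
  also have "\<dots> = (\<alpha>\<^sup>2 + 2) * \<epsilon> * v\<^sup>2" by (simp add: power2_eq_square algebra_simps)
  finally have "K * (hilb_norm (T x - scale z x))\<^sup>2 \<le> K * ((\<alpha>\<^sup>2 + 2) * \<epsilon> * v\<^sup>2)"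
    using K(1) by (intro mult_left_mono) auto
  also have "\<dots> = (K * (\<alpha>\<^sup>2 + 2) * \<epsilon>) * v\<^sup>2" by simp
  also have "\<dots> \<le> 1 / 4 * v\<^sup>2" using \<epsilon> by (intro mult_right_mono) auto
  finally have "(hilb_norm x)\<^sup>2 \<le> 1 / 4 * v\<^sup>2" using K(2)[OF x] by simp
  \<comment> \<open>The weight 1/2 gives \<open>v\<^sup>2 / 2\<close>, which exceeds the bound
    \<open>v\<^sup>2 / 4\<close>.\<close>
  moreover have "(hilb_norm x)\<^sup>2 = v\<^sup>2 / 2"
    unfolding hilb_norm_square by (simp add: x_def gn)
  ultimately show False using B(3) by simp
qed

lemma norm_diff_square_le: "(cmod (x - y))\<^sup>2 \<le> 2 * (cmod x)\<^sup>2 + 2 * (cmod y)\<^sup>2"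
proof -
  have "(cmod (x - y))\<^sup>2 \<le> (cmod x + cmod y)\<^sup>2"
    by (intro power_mono norm_triangle_ineq4) auto
  also have "\<dots> \<le> 2 * (cmod x)\<^sup>2 + 2 * (cmod y)\<^sup>2"
    using sum_squares_bound[of "cmod x" "cmod y"] by (simp add: power2_sum)
  finally show ?thesis .
qed

context schur
begin

text \<open>In the decomposition of \<open>S_eq\<close> the gap bounds both
  \<open>phi (z - \<omega> k)\<close> and \<open>pot z f\<close>, so \<open>S z f\<close> is a
  bounded multiple of \<open>f\<close> plus a bounded multiple of \<open>cnj lam\<close>.\<close>

lemma S_L2:
  assumes z: "gap z s" and f: "f \<in> L2"
  shows "S z f \<in> L2"
proof -
  have s: "s > 0" using z by (simp add: gap_def)
  define L where "L = (LINT q|lborel. (cmod (lam q))\<^sup>2)"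
  define \<psi> where "\<psi> = (\<lambda>k. LINT q|lborel. (cmod (lam q))\<^sup>2 / (\<omega> q + b - (z - \<omega> k)))"
  have "\<psi> \<in> borel_measurable lborel" unfolding \<psi>_def by measurable
  then have [measurable]: "\<psi> \<in> borel_measurable borel" by simp
  have \<psi>: "\<bar>\<psi> k\<bar> \<le> L / s" for k
  proof -
    have "\<bar>\<psi> k\<bar> \<le> (LINT q|lborel. \<bar>(cmod (lam q))\<^sup>2 / (\<omega> q + b - (z - \<omega> k))\<bar>)"
      unfolding \<psi>_def by (rule integral_abs_bound)
    also have "\<dots> \<le> (LINT q|lborel. (cmod (lam q))\<^sup>2 / s)"
    proof (rule integral_mono')
      fix q
      have "s \<le> \<bar>\<omega> q + b - (z - \<omega> k)\<bar>" using z by (auto simp: gap_def algebra_simps)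
      then show "\<bar>(cmod (lam q))\<^sup>2 / (\<omega> q + b - (z - \<omega> k))\<bar> \<le> (cmod (lam q))\<^sup>2 / s"
        using s unfolding abs_divide by (intro frac_le) auto
    qed (use lam_nsq_integrable s in auto)
    finally show ?thesis by (simp add: L_def)
  qed
  have phi: "phi (z - \<omega> k) = a - (z - \<omega> k) - \<alpha>\<^sup>2 * \<psi> k" for k
    by (simp add: phi_def \<psi>_def)
  have "(\<lambda>k. complex_of_real (phi (z - \<omega> k)) * f k) \<in> L2"
  proof (rule L2_mult_bounded[OF f])
    show "(\<lambda>k. complex_of_real (phi (z - \<omega> k))) \<in> borel_measurable borel"
      unfolding phi by measurable
    fix k
    have "\<alpha>\<^sup>2 * \<bar>\<psi> k\<bar> \<le> \<alpha>\<^sup>2 * (L / s)" by (intro mult_left_mono \<psi>) auto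
    then have "\<bar>\<alpha>\<^sup>2 * \<psi> k\<bar> \<le> \<alpha>\<^sup>2 * (L / s)" by (simp only: abs_mult abs_power2)
    then show "cmod (complex_of_real (phi (z - \<omega> k))) \<le> \<bar>a\<bar> + \<bar>z\<bar> + (\<bar>lo\<bar> + \<bar>hi\<bar>) + \<alpha>\<^sup>2 * (L / s)"
      unfolding norm_of_real phi using \<omega>_bounded[of k] by linarith
  qed
  moreover have "(\<lambda>k. - complex_of_real (\<alpha>\<^sup>2) * (pot z f k * cnj (lam k))) \<in> L2"
    by (intro L2_scale L2_mult_bounded[OF L2_cnj[OF lam] pot_meas[OF f] pot_bound[OF z f]])
  ultimately have "(\<lambda>k. complex_of_real (phi (z - \<omega> k)) * f k + - complex_of_real (\<alpha>\<^sup>2) * (pot z f k * cnj (lam k))) \<in> L2"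
    by (rule L2_add)
  moreover have "S z f k = complex_of_real (phi (z - \<omega> k)) * f k + - complex_of_real (\<alpha>\<^sup>2) * (pot z f k * cnj (lam k))" for k
    unfolding S_eq[OF z f] by (simp add: mult_ac)
  ultimately show ?thesis by presburger
qed

text \<open>Here \<open>f\<close> is the indicator of a small ball around \<open>k0\<close>, and the second component is chosen
  such that the operator matrix minus \<open>z\<close> maps the pair to \<open>(S z f, 0)\<close>.\<close>

lemma spectrum_one_particle:
  assumes cont: "continuous_on UNIV \<omega>" and z: "gap z s" "z = \<omega> k0 + E" and E: "phi E = 0" and ab: "a = - b"
  shows "complex_of_real z \<in> spectrum (op_matrix \<omega> lam b \<alpha>)"
proof (rule ccontr)
  define T where "T = op_matrix \<omega> lam b \<alpha>"
  assume "complex_of_real z \<notin> spectrum (op_matrix \<omega> lam b \<alpha>)"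
  then have "complex_of_real z \<in> resolvent_set T" by (simp add: spectrum_def T_def)
  then obtain K where K: "K > 0" "\<And>x. x \<in> hilb \<Longrightarrow> T x - scale z x \<in> hilb \<Longrightarrow>
      (hilb_norm x)\<^sup>2 \<le> K * (hilb_norm (T x - scale z x))\<^sup>2"
    using resolvent_bound by blast
  have s: "s > 0" using z by (simp add: gap_def)
  define L where "L = (LINT q|lborel. (cmod (lam q))\<^sup>2)"
  have L: "L \<ge> 0" by (simp add: L_def)
  \<comment> \<open>On the ball \<open>phi (z - \<omega> k)\<close> will be at most
    \<open>C * \<epsilon>\<close> in modulus: 1 comes from its linear term, the rest from the
    difference of two reciprocals with denominators at least \<open>s\<close>.\<close>
  define C where "C = 1 + \<alpha>\<^sup>2 * (L / s\<^sup>2)"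
  have C: "C \<ge> 1" using L by (simp add: C_def)
  \<comment> \<open>Collects the constants of the final residual estimate: the first summand belongs
    to the multiplier, the second to the integral operator.\<close>
  define c where "c = K * (2 * C\<^sup>2 + 2 * (\<alpha>\<^sup>2)\<^sup>2 * L / s\<^sup>2)"
  have c: "c > 0" unfolding c_def using K(1) C L by (intro mult_pos_pos add_pos_nonneg) auto
  define \<epsilon> where "\<epsilon> = min 1 (1 / (4 * c))"
  have "c * \<epsilon> \<le> c * (1 / (4 * c))" using c by (intro mult_left_mono) (auto simp: \<epsilon>_def)
  also have "\<dots> = 1 / 4" using c by simp
  finally have \<epsilon>: "\<epsilon> > 0" "\<epsilon> \<le> 1" "c * \<epsilon> \<le> 1 / 4"
    using c by (auto simp: \<epsilon>_def)
  obtain d where d: "d > 0" "\<And>k. k \<in> ball k0 d \<Longrightarrow> \<bar>\<omega> k - \<omega> k0\<bar> < \<epsilon>"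
    "(LINT q|lborel. (cmod (indicator (ball k0 d) q * lam q))\<^sup>2) < \<epsilon>"
    using concentrated_ball[OF cont lam \<epsilon>(1)] by blast
  define f :: "'a \<Rightarrow> complex" where "f = indicator (ball k0 d)"
  define v where "v = measure lborel (ball k0 d)"
  have f: "f \<in> L2" "(LINT k|lborel. (cmod (f k))\<^sup>2) = v" "v > 0"
    using ball_L2[OF d(1), of k0] by (auto simp: f_def v_def)
  define x :: "'a state" where "x = (f, \<lambda>p. - resC z f p)"
  have den: "\<omega> k + \<omega> q + b - z \<noteq> 0" for k q
    using z(1) s unfolding gap_def by (metis abs_zero not_le)
  have den': "complex_of_real (\<omega> k) + complex_of_real (\<omega> q) + complex_of_real b - complex_of_real z \<noteq> 0" for k q
    using den[of k q] by (simp flip: of_real_add of_real_diff)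
  have T2: "complex_of_real (b + \<omega> k + \<omega> q) * resC z f (k, q) - complex_of_real z * resC z f (k, q)
      = opC lam \<alpha> f (k, q)" for k q
  proof -
    have "complex_of_real (b + \<omega> k + \<omega> q) * resC z f (k, q) - complex_of_real z * resC z f (k, q)
      = complex_of_real (\<omega> k + \<omega> q + b - z) * resC z f (k, q)"
      by (simp add: algebra_simps)
    then show ?thesis using den'[of k q] by (simp add: resC_def)
  qed
  have B: "opB lam \<alpha> (\<lambda>p. - resC z f p) k = - opB lam \<alpha> (resC z f) k" for k
    by (simp add: opB_def)
  have Tx: "T x - scale z x = (S z f, \<lambda>p. 0)"
  proof (rule prod_eqI; rule ext)
    show "fst (T x - scale z x) k = fst (S z f, \<lambda>p. 0) k" for k
      unfolding fst_conv S_def by (simp add: T_def x_def op_matrix_def scale_def opA_def B ab algebra_simps)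
    show "snd (T x - scale z x) p = snd (S z f, \<lambda>p. 0) p" for p
      using T2[of "fst p" "snd p"]
      by (cases p) (simp add: T_def x_def op_matrix_def scale_def opD_def algebra_simps)
  qed
  have "(\<lambda>p. - 1 * resC z f p) \<in> L2" by (intro L2_scale resC_L2[OF z(1)] f)
  moreover have "AE p in lborel. resC z f (fst p, snd p) = resC z f (snd p, fst p)"
    using resC_L2s[OF z(1) f(1)] by (simp add: L2s_def)
  ultimately have x: "x \<in> hilb" "T x - scale z x \<in> hilb"
    using f(1) S_L2[OF z(1) f(1)] unfolding Tx by (auto simp: x_def hilb_def L2s_def intro: L2_zero)
  define M where "M = (LINT q|lborel. cmod (lam q) * cmod (f q))"
  have M: "M\<^sup>2 \<le> \<epsilon> * v"
    using lam_ball_Cauchy_Schwarz[OF lam d(1), of k0] d(3) f(3)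
    unfolding f_def v_def M_def by (smt (verit) mult_right_mono)
  have phi: "\<bar>phi (z - \<omega> k)\<bar> \<le> C * \<epsilon>" if "k \<in> ball k0 d" for k
  proof -
    have r: "s \<le> \<bar>\<omega> q + b - (z - \<omega> k)\<bar>" "s \<le> \<bar>\<omega> q + b - E\<bar>" for q
    proof -
      have "\<omega> q + b - (z - \<omega> k) = \<omega> k + \<omega> q + b - z" "\<omega> q + b - E = \<omega> k0 + \<omega> q + b - z"
        by (simp_all add: z(2))
      then show "s \<le> \<bar>\<omega> q + b - (z - \<omega> k)\<bar>" "s \<le> \<bar>\<omega> q + b - E\<bar>"
        using z(1) by (auto simp only: gap_def)
    qed
    have i: "integrable lborel (\<lambda>q. (cmod (lam q))\<^sup>2 / (\<omega> q + b - t))" if "\<And>q. s \<le> \<bar>\<omega> q + b - t\<bar>" for t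
    proof (rule Bochner_Integration.integrable_bound)
      show "integrable lborel (\<lambda>q. (cmod (lam q))\<^sup>2 / s)" using lam_nsq_integrable by simp
      show "AE q in lborel. norm ((cmod (lam q))\<^sup>2 / (\<omega> q + b - t)) \<le> norm ((cmod (lam q))\<^sup>2 / s)"
        using that s by (intro AE_I2) (auto simp: abs_divide intro!: frac_le)
    qed measurable
    define \<delta> where "\<delta> = \<omega> k - \<omega> k0"
    have \<delta>: "\<bar>\<delta>\<bar> \<le> \<epsilon>" using d(2)[OF that] by (simp add: \<delta>_def)
    have "\<bar>(LINT q|lborel. (cmod (lam q))\<^sup>2 / (\<omega> q + b - (z - \<omega> k))) - (LINT q|lborel. (cmod (lam q))\<^sup>2 / (\<omega> q + b - E))\<bar>
      = \<bar>LINT q|lborel. (cmod (lam q))\<^sup>2 / (\<omega> q + b - (z - \<omega> k)) - (cmod (lam q))\<^sup>2 / (\<omega> q + b - E)\<bar>"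
      using i r by simp
    also have "\<dots> \<le> (LINT q|lborel. \<bar>(cmod (lam q))\<^sup>2 / (\<omega> q + b - (z - \<omega> k)) - (cmod (lam q))\<^sup>2 / (\<omega> q + b - E)\<bar>)"
      by (rule integral_abs_bound)
    also have "\<dots> \<le> (LINT q|lborel. \<epsilon> / s\<^sup>2 * (cmod (lam q))\<^sup>2)"
    proof (rule integral_mono')
      fix q
      define X Y where "X = \<omega> q + b - (z - \<omega> k)" and "Y = \<omega> q + b - E"
      have XY: "s \<le> \<bar>X\<bar>" "s \<le> \<bar>Y\<bar>" using r[of q] by (auto simp: X_def Y_def)
      then have "X \<noteq> 0" "Y \<noteq> 0" using s by auto
      \<comment> \<open>The two denominators differ by \<open>X - Y = \<delta>\<close>, the
        variation of \<open>\<omega>\<close> on the ball.\<close>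
      then have "1 / X - 1 / Y = - \<delta> / (X * Y)"
        by (simp add: divide_simps) (simp add: X_def Y_def \<delta>_def z(2))
      then have "\<bar>1 / X - 1 / Y\<bar> = \<bar>\<delta>\<bar> / (\<bar>X\<bar> * \<bar>Y\<bar>)" by (simp add: abs_mult)
      also have "\<dots> \<le> \<epsilon> / (s * s)"
        using XY s \<delta> \<epsilon>(1) by (intro frac_le mult_mono) auto
      finally have "(cmod (lam q))\<^sup>2 * \<bar>1 / X - 1 / Y\<bar> \<le> (cmod (lam q))\<^sup>2 * (\<epsilon> / (s * s))"
        by (intro mult_left_mono) auto
      moreover have "(cmod (lam q))\<^sup>2 / X - (cmod (lam q))\<^sup>2 / Y = (cmod (lam q))\<^sup>2 * (1 / X - 1 / Y)"
        by (simp add: right_diff_distrib)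
      ultimately show "\<bar>(cmod (lam q))\<^sup>2 / (\<omega> q + b - (z - \<omega> k)) - (cmod (lam q))\<^sup>2 / (\<omega> q + b - E)\<bar>
          \<le> \<epsilon> / s\<^sup>2 * (cmod (lam q))\<^sup>2"
        unfolding X_def[symmetric] Y_def[symmetric] by (simp add: abs_mult power2_eq_square mult_ac)
    qed (use lam_nsq_integrable \<epsilon> in auto)
    also have "\<dots> = \<epsilon> * (L / s\<^sup>2)" by (simp add: L_def)
    finally have "\<alpha>\<^sup>2 * \<bar>(LINT q|lborel. (cmod (lam q))\<^sup>2 / (\<omega> q + b - (z - \<omega> k)))
        - (LINT q|lborel. (cmod (lam q))\<^sup>2 / (\<omega> q + b - E))\<bar> \<le> \<alpha>\<^sup>2 * (\<epsilon> * (L / s\<^sup>2))"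
      by (intro mult_left_mono) auto
    moreover have "phi (z - \<omega> k) - phi E = \<delta> - \<alpha>\<^sup>2 * ((LINT q|lborel. (cmod (lam q))\<^sup>2 / (\<omega> q + b - (z - \<omega> k)))
        - (LINT q|lborel. (cmod (lam q))\<^sup>2 / (\<omega> q + b - E)))"
      by (simp add: phi_def \<delta>_def z(2) algebra_simps)
    ultimately have "\<bar>phi (z - \<omega> k)\<bar> \<le> \<epsilon> + \<alpha>\<^sup>2 * (\<epsilon> * (L / s\<^sup>2))"
      using E \<delta> abs_triangle_ineq4[of \<delta> "\<alpha>\<^sup>2 * ((LINT q|lborel. (cmod (lam q))\<^sup>2 / (\<omega> q + b - (z - \<omega> k)))
        - (LINT q|lborel. (cmod (lam q))\<^sup>2 / (\<omega> q + b - E)))"]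
      by (simp add: abs_mult)
    then show ?thesis by (simp add: C_def algebra_simps)
  qed
  \<comment> \<open>The multiplier acts on \<open>f\<close> only inside the ball, where
    \<open>phi\<close> is small. The integral operator is controlled by \<open>M\<close>, the
    integral of \<open>|lam|\<close> over the ball.\<close>
  have bound: "(cmod (S z f k))\<^sup>2 \<le> 2 * (C * \<epsilon>)\<^sup>2 * (cmod (f k))\<^sup>2 + 2 * (\<alpha>\<^sup>2)\<^sup>2 * (M / s)\<^sup>2 * (cmod (lam k))\<^sup>2" for k
  proof -
    have "(cmod (S z f k))\<^sup>2 \<le> 2 * (cmod (complex_of_real (phi (z - \<omega> k)) * f k))\<^sup>2
        + 2 * (cmod (complex_of_real (\<alpha>\<^sup>2) * cnj (lam k) * pot z f k))\<^sup>2"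
      unfolding S_eq[OF z(1) f(1)] by (rule norm_diff_square_le)
    moreover have "(cmod (complex_of_real (phi (z - \<omega> k)) * f k))\<^sup>2 \<le> (C * \<epsilon>)\<^sup>2 * (cmod (f k))\<^sup>2"
    proof (cases "k \<in> ball k0 d")
      case True
      then have "\<bar>phi (z - \<omega> k)\<bar>\<^sup>2 \<le> (C * \<epsilon>)\<^sup>2" using phi by (intro power_mono) auto
      then show ?thesis unfolding norm_mult norm_of_real power_mult_distrib[of "\<bar>phi (z - \<omega> k)\<bar>"]
        by (intro mult_right_mono) auto
    qed (auto simp: f_def)
    moreover have "(cmod (complex_of_real (\<alpha>\<^sup>2) * cnj (lam k) * pot z f k))\<^sup>2 \<le> (\<alpha>\<^sup>2)\<^sup>2 * (M / s)\<^sup>2 * (cmod (lam k))\<^sup>2"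
    proof -
      have "(cmod (pot z f k))\<^sup>2 \<le> (M / s)\<^sup>2"
        using pot_bound[OF z(1) f(1), of k] unfolding M_def by (intro power_mono) auto
      then have "((\<alpha>\<^sup>2)\<^sup>2 * (cmod (lam k))\<^sup>2) * (cmod (pot z f k))\<^sup>2 \<le> ((\<alpha>\<^sup>2)\<^sup>2 * (cmod (lam k))\<^sup>2) * (M / s)\<^sup>2"
        by (intro mult_left_mono) auto
      then show ?thesis
        by (simp add: norm_mult power_mult_distrib norm_power mult_ac)
    qed
    ultimately show ?thesis by linarith
  qed
  have "(hilb_norm (T x - scale z x))\<^sup>2 = (LINT k|lborel. (cmod (S z f k))\<^sup>2)"
    unfolding Tx hilb_norm_square by simp
  also have "\<dots> \<le> (LINT k|lborel. 2 * (C * \<epsilon>)\<^sup>2 * (cmod (f k))\<^sup>2 + 2 * (\<alpha>\<^sup>2)\<^sup>2 * (M / s)\<^sup>2 * (cmod (lam k))\<^sup>2)"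
    using L2_D(2)[OF S_L2[OF z(1) f(1)]] L2_D(2)[OF f(1)] lam_nsq_integrable bound
    by (intro integral_mono) auto
  also have "\<dots> = 2 * (C * \<epsilon>)\<^sup>2 * v + 2 * (\<alpha>\<^sup>2)\<^sup>2 * (M\<^sup>2 / s\<^sup>2) * L"
    using L2_D(2)[OF f(1)] lam_nsq_integrable by (simp add: f(2) L_def power_divide)
  also have "\<dots> \<le> 2 * (C\<^sup>2 * \<epsilon>) * v + 2 * (\<alpha>\<^sup>2)\<^sup>2 * ((\<epsilon> * v) / s\<^sup>2) * L"
    using \<epsilon> M f(3) L unfolding power_mult_distrib
    by (intro add_mono mult_right_mono mult_left_mono divide_right_mono) (auto simp: power2_eq_square mult_left_le)
  also have "\<dots> = (2 * C\<^sup>2 + 2 * (\<alpha>\<^sup>2)\<^sup>2 * L / s\<^sup>2) * \<epsilon> * v" by (simp add: algebra_simps)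
  finally have "K * (hilb_norm (T x - scale z x))\<^sup>2 \<le> K * ((2 * C\<^sup>2 + 2 * (\<alpha>\<^sup>2)\<^sup>2 * L / s\<^sup>2) * \<epsilon> * v)"
    using K(1) by (intro mult_left_mono) auto
  also have "\<dots> = (c * \<epsilon>) * v" by (simp add: c_def)
  also have "\<dots> \<le> 1 / 4 * v" using \<epsilon> f(3) by (intro mult_right_mono) auto
  finally have "(hilb_norm x)\<^sup>2 \<le> 1 / 4 * v" using K(2)[OF x] by simp
  moreover have "(hilb_norm x)\<^sup>2 \<ge> v"
    unfolding hilb_norm_square by (simp add: x_def f(2))
  ultimately show False using f(3) by simp
qed

end

section \<open>Accumulation points\<close>

context schur
begin

text \<open>Pairing the two rows of the eigenvalue equation with \<open>f\<close> and
  \<open>g\<close> gives real diagonal terms and coupling terms that are conjugate up to the weight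
  1/2. Hence \<open>z\<close> times a positive number is real.\<close>

lemma eigenvalue_real:
  assumes "eigenvalue (op_matrix \<omega> lam b \<alpha>) z"
  shows "Im z = 0"
proof -
  obtain x where "x \<in> eigenspace (op_matrix \<omega> lam b \<alpha>) z" "\<not> hilb_eq x 0"
    using assms by (auto simp: eigenvalue_def)
  then obtain f g where fg: "f \<in> L2" "g \<in> L2s"
    "\<not> ((AE k in lborel. f k = 0) \<and> (AE p in lborel. g p = 0))"
    "AE k in lborel. complex_of_real (- b + \<omega> k) * f k + opB lam \<alpha> g k = z * f k"
    "AE p in lborel. opC lam \<alpha> f p + complex_of_real (b + \<omega> (fst p) + \<omega> (snd p)) * g p = z * g p"
    by (cases x) (auto simp: eigenspace_def hilb_def hilb_eq_def op_matrix_def scale_def opA_def opD_def case_prod_unfold)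
  have g: "g \<in> L2" using fg by (simp add: L2s_def)
  note adj = opB_opC_adjoint[OF fg(2) lam fg(1), of \<alpha>]
  define w where "w = (LINT p|lborel. g p * cnj (opC lam \<alpha> f p))"
  have sq: "c * u * cnj u = c * complex_of_real ((cmod u)\<^sup>2)" for c u :: complex
    unfolding complex_norm_square by simp
  obtain W where W: "\<bar>\<omega> k\<bar> \<le> W" for k using \<omega>_bounded by blast
  have i1: "integrable lborel (\<lambda>k. complex_of_real ((- b + \<omega> k) * (cmod (f k))\<^sup>2))"
  proof -
    have "(\<lambda>k. complex_of_real (- b + \<omega> k) * f k) \<in> L2"
    proof (rule L2_mult_bounded[OF fg(1)])
      fix k
      show "cmod (complex_of_real (- b + \<omega> k)) \<le> \<bar>b\<bar> + W"
        unfolding norm_of_real using W[of k] by linarith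
    qed measurable
    from L2_mult_integrable(2)[OF this L2_cnj[OF fg(1)]] show ?thesis
      unfolding sq of_real_mult .
  qed
  have i2: "integrable lborel (\<lambda>p. complex_of_real ((b + \<omega> (fst p) + \<omega> (snd p)) * (cmod (g p))\<^sup>2))"
  proof -
    have "(\<lambda>p. complex_of_real (b + \<omega> (fst p) + \<omega> (snd p)) * g p) \<in> L2"
    proof (rule L2_mult_bounded[OF g])
      fix p
      show "cmod (complex_of_real (b + \<omega> (fst p) + \<omega> (snd p))) \<le> \<bar>b\<bar> + 2 * W"
        unfolding norm_of_real using W[of "fst p"] W[of "snd p"] by linarith
    qed measurable
    from L2_mult_integrable(2)[OF this L2_cnj[OF g]] show ?thesis
      unfolding sq of_real_mult .
  qed
  have i3: "integrable lborel (\<lambda>p. opC lam \<alpha> f p * cnj (g p))"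
    by (intro L2_mult_integrable(2) opC_L2 fg(1) L2_cnj g)
  have "AE k in lborel. complex_of_real ((- b + \<omega> k) * (cmod (f k))\<^sup>2) + opB lam \<alpha> g k * cnj (f k)
      = z * complex_of_real ((cmod (f k))\<^sup>2)"
    using fg(4) by eventually_elim (simp only: of_real_mult sq[symmetric], simp only: distrib_right[symmetric])
  then have "(LINT k|lborel. complex_of_real ((- b + \<omega> k) * (cmod (f k))\<^sup>2) + opB lam \<alpha> g k * cnj (f k))
      = (LINT k|lborel. z * complex_of_real ((cmod (f k))\<^sup>2))"
    using i1 adj(1) integrable_of_real[OF L2_D(2)[OF fg(1)]]
    by (intro integral_cong_AE borel_measurable_integrable Bochner_Integration.integrable_add
        integrable_mult_right)
  then have 1: "complex_of_real (LINT k|lborel. (- b + \<omega> k) * (cmod (f k))\<^sup>2) + w / 2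
      = z * complex_of_real (LINT k|lborel. (cmod (f k))\<^sup>2)"
    using i1 adj by (simp only: Bochner_Integration.integral_add integral_mult_right_zero integral_complex_of_real w_def)
  have "AE p in lborel. opC lam \<alpha> f p * cnj (g p) + complex_of_real ((b + \<omega> (fst p) + \<omega> (snd p)) * (cmod (g p))\<^sup>2)
      = z * complex_of_real ((cmod (g p))\<^sup>2)"
    using fg(5) by eventually_elim (simp only: of_real_mult sq[symmetric], simp only: distrib_right[symmetric])
  then have "(LINT p|lborel. opC lam \<alpha> f p * cnj (g p) + complex_of_real ((b + \<omega> (fst p) + \<omega> (snd p)) * (cmod (g p))\<^sup>2))
      = (LINT p|lborel. z * complex_of_real ((cmod (g p))\<^sup>2))"
    using i2 i3 integrable_of_real[OF L2_D(2)[OF g]]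
    by (intro integral_cong_AE borel_measurable_integrable Bochner_Integration.integrable_add
        integrable_mult_right)
  moreover have "(LINT p|lborel. opC lam \<alpha> f p * cnj (g p)) = cnj w"
    unfolding w_def Bochner_Integration.integral_cnj[symmetric] by (simp add: mult.commute)
  ultimately have 2: "cnj w + complex_of_real (LINT p|lborel. (b + \<omega> (fst p) + \<omega> (snd p)) * (cmod (g p))\<^sup>2)
      = z * complex_of_real (LINT p|lborel. (cmod (g p))\<^sup>2)"
    using i2 i3 by (simp only: Bochner_Integration.integral_add integral_mult_right_zero integral_complex_of_real)
  \<comment> \<open>Halving the second identity makes the imaginary parts of \<open>w / 2\<close>
    and \<open>cnj w / 2\<close> cancel.\<close>
  have "Im z * ((LINT k|lborel. (cmod (f k))\<^sup>2) + (LINT p|lborel. (cmod (g p))\<^sup>2) / 2) = 0"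
    using arg_cong[OF 1, of Im] arg_cong[OF 2, of Im] by (simp add: algebra_simps)
  moreover have "(LINT k|lborel. (cmod (f k))\<^sup>2) + (LINT p|lborel. (cmod (g p))\<^sup>2) / 2 \<noteq> 0"
  proof
    assume *: "(LINT k|lborel. (cmod (f k))\<^sup>2) + (LINT p|lborel. (cmod (g p))\<^sup>2) / 2 = 0"
    have "(LINT k|lborel. (cmod (f k))\<^sup>2) \<ge> 0" "(LINT p|lborel. (cmod (g p))\<^sup>2) \<ge> 0" by simp_all
    with * have "(LINT k|lborel. (cmod (f k))\<^sup>2) = 0" "(LINT p|lborel. (cmod (g p))\<^sup>2) = 0" by linarith+
    then show False
      using fg(3) integral_nonneg_eq_0_iff_AE[OF L2_D(2)[OF fg(1)]] integral_nonneg_eq_0_iff_AE[OF L2_D(2)[OF g]]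
      by simp
  qed
  ultimately show ?thesis by simp
qed

lemma AE_pair_zero:
  fixes f :: "'a \<Rightarrow> complex"
  assumes f: "f \<in> L2" and "AE k in lborel. f k = 0"
  shows "AE p in lborel. f (fst p) = 0 \<and> f (snd p) = 0"
proof -
  note [measurable] = L2_D(1)[OF f]
  have "AE p in lborel \<Otimes>\<^sub>M lborel. f (fst p) = 0 \<and> f (snd p) = 0"
  proof (rule lborel_pair.AE_pair_measure)
    show "{p \<in> space (lborel \<Otimes>\<^sub>M lborel). f (fst p) = 0 \<and> f (snd p) = 0} \<in> sets (lborel \<Otimes>\<^sub>M lborel)"
      by measurable
    show "AE k in lborel. AE q in lborel. f (fst (k, q)) = 0 \<and> f (snd (k, q)) = 0"
      using assms(2) by eventually_elim (use assms(2) in simp)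
  qed
  then show ?thesis unfolding lborel_prod .
qed

text \<open>The gap allows the second row to be solved as \<open>g = - resC z f\<close>;
  substitution into the first row gives \<open>S z f = 0\<close>. If \<open>f\<close> vanished,
  \<open>g\<close> would vanish too.\<close>

lemma eigenvalue_kernel:
  assumes ev: "eigenvalue (op_matrix \<omega> lam b \<alpha>) (complex_of_real z)" and gap: "gap z s" and ab: "a = - b"
  shows "\<exists>f\<in>L2. \<not> (AE k in lborel. f k = 0) \<and> (AE k in lborel. S z f k = 0)"
proof -
  obtain x where "x \<in> eigenspace (op_matrix \<omega> lam b \<alpha>) z" "\<not> hilb_eq x 0"
    using assms by (auto simp: eigenvalue_def)
  then obtain f g where fg: "f \<in> L2" "g \<in> L2"
    "\<not> ((AE k in lborel. f k = 0) \<and> (AE p in lborel. g p = 0))"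
    "AE k in lborel. complex_of_real (- b + \<omega> k) * f k + opB lam \<alpha> g k = complex_of_real z * f k"
    "AE p in lborel. opC lam \<alpha> f p + complex_of_real (b + \<omega> (fst p) + \<omega> (snd p)) * g p = complex_of_real z * g p"
    by (cases x) (auto simp: eigenspace_def hilb_def L2s_def hilb_eq_def op_matrix_def scale_def opA_def opD_def case_prod_unfold)
  note [measurable] = L2_D(1)[OF fg(1)] L2_D(1)[OF fg(2)] L2_D(1)[OF resC_L2[OF gap fg(1)]]
  have g: "AE p in lborel. g p = - resC z f p"
    using fg(5)
  proof eventually_elim
    case (elim p)
    have "\<omega> (fst p) + \<omega> (snd p) + b - z \<noteq> 0"
      using gap unfolding gap_def by (metis abs_zero not_le)
    then have "complex_of_real (\<omega> (fst p) + \<omega> (snd p) + b - z) \<noteq> 0"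
      by (simp only: of_real_eq_0_iff not_False_eq_True)
    moreover have "complex_of_real (\<omega> (fst p) + \<omega> (snd p) + b - z) * g p = - opC lam \<alpha> f p"
      using elim by (simp add: algebra_simps add_eq_0_iff2)
    ultimately show ?case unfolding resC_def by (simp add: field_simps)
  qed
  \<comment> \<open>The integral in \<open>opB\<close> runs over sections of \<open>g\<close>, so
    the identity has to be passed to almost every section.\<close>
  then have "AE p in lborel \<Otimes>\<^sub>M lborel. g p = - resC z f p"
    unfolding lborel_prod .
  then have "AE k in lborel. AE q in lborel. g (k, q) = - resC z f (k, q)"
    by (rule lborel_pair.AE_pair)
  then have B: "AE k in lborel. opB lam \<alpha> g k = - opB lam \<alpha> (resC z f) k"
  proof eventually_elim
    case (elim k)
    have "(LINT q|lborel. g (k, q) * lam q) = (LINT q|lborel. - (resC z f (k, q) * lam q))"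
    proof (rule integral_cong_AE)
      have P: "Pair k \<in> borel_measurable borel"
        by (intro borel_measurable_continuous_onI continuous_intros)
      show "(\<lambda>q. g (k, q) * lam q) \<in> borel_measurable lborel"
        "(\<lambda>q. - (resC z f (k, q) * lam q)) \<in> borel_measurable lborel"
        using measurable_compose[OF P L2_D(1)[OF fg(2)]]
          measurable_compose[OF P L2_D(1)[OF resC_L2[OF gap fg(1)]]] by auto
      show "AE q in lborel. g (k, q) * lam q = - (resC z f (k, q) * lam q)"
        using elim by eventually_elim simp
    qed
    then show ?case by (simp add: opB_def)
  qed
  have "AE k in lborel. S z f k = 0"
    using B fg(4)
  proof eventually_elim
    case (elim k)
    then show ?case unfolding S_def by (simp add: ab algebra_simps)
  qed
  moreover have "\<not> (AE k in lborel. f k = 0)"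
  proof
    assume f0: "AE k in lborel. f k = 0"
    have "AE p in lborel. g p = 0"
      using g AE_pair_zero[OF fg(1) f0]
      by eventually_elim (simp add: resC_def opC_def case_prod_unfold)
    with f0 fg(3) show False by simp
  qed
  ultimately show ?thesis using fg(1) by blast
qed

end

section \<open>Isolated points and limit points\<close>

lemma not_isolated_in_interval:
  fixes S :: "complex set"
  assumes "a < t" "t < b" and "\<And>u. a < u \<Longrightarrow> u < b \<Longrightarrow> u \<noteq> t' \<Longrightarrow> complex_of_real u \<in> S"
  shows "\<not> complex_of_real t isolated_in S"
proof -
  have "complex_of_real t islimpt S"
    unfolding islimpt_approachable
  proof (intro allI impI)
    fix e :: real assume "e > 0"
    define d where "d = min e (b - t)"
    have d: "d > 0" "d \<le> e" "d \<le> b - t" using assms \<open>e > 0\<close> by (auto simp: d_def)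
    \<comment> \<open>At most one of the two candidates can be the exceptional point
      \<open>t'\<close>.\<close>
    define u where "u = (if t + d / 2 = t' then t + d / 3 else t + d / 2)"
    have u: "t < u" "u < t + d" "u \<noteq> t'" using d by (auto simp: u_def)
    have "dist (complex_of_real u) (complex_of_real t) = \<bar>u - t\<bar>"
      by (simp only: dist_of_real dist_real_def)
    then show "\<exists>x'\<in>S. x' \<noteq> complex_of_real t \<and> dist x' (complex_of_real t) < e"
      using u d assms by (intro bexI[of _ "complex_of_real u"]) auto
  qed
  then show ?thesis by (simp add: isolated_in_islimpt_iff)
qed

text \<open>On real points complex and real distances agree, so counting in a real ball
  suffices.\<close>

lemma not_islimpt_real_set:
  fixes D :: "complex set"
  assumes "\<And>z. z \<in> D \<Longrightarrow> Im z = 0" and "\<exists>\<delta>>0. finite ({t. complex_of_real t \<in> D} \<inter> ball z \<delta>)"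
  shows "\<not> complex_of_real z islimpt D"
proof -
  obtain \<delta> where \<delta>: "\<delta> > 0" "finite ({t. complex_of_real t \<in> D} \<inter> ball z \<delta>)"
    using assms(2) by blast
  have "D \<inter> ball (complex_of_real z) \<delta> \<subseteq> complex_of_real ` ({t. complex_of_real t \<in> D} \<inter> ball z \<delta>)"
  proof
    fix w assume w: "w \<in> D \<inter> ball (complex_of_real z) \<delta>"
    then have eq: "w = complex_of_real (Re w)" using assms(1) by (auto simp: complex_eq_iff)
    then have "dist z (Re w) < \<delta>" using w by (metis IntD2 mem_ball dist_of_real)
    then show "w \<in> complex_of_real ` ({t. complex_of_real t \<in> D} \<inter> ball z \<delta>)"
      using w eq by (intro image_eqI[of _ _ "Re w"]) auto
  qed
  then show ?thesis
    using \<delta> unfolding islimpt_eq_infinite_ball by (meson finite_imageI finite_subset)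
qed

theorem theorem2p3:
  fixes \<omega> :: "real ^ 'd \<Rightarrow> real"
    and lam :: "real ^ 'd \<Rightarrow> complex"
    and \<gamma> \<alpha> \<omega>\<^sub>0 \<omega>\<^sub>1 :: real
  assumes "\<And>x. 0 \<le> \<omega> x"
    and "\<not> \<omega> constant_on UNIV"
    and "bounded (range \<omega>)"
    and "continuous_on UNIV \<omega>"
    and "lam \<in> L2"
    and "\<not> (AE q in lborel. lam q = 0)"
    and "\<omega>\<^sub>0 = (INF x. \<omega> x)"
    and "\<omega>\<^sub>1 = (SUP x. \<omega> x)"
    and "\<alpha> > 0"
  shows "(\<forall>E. E < \<omega>\<^sub>0 + \<gamma> \<and> Phi \<omega> lam \<gamma> \<alpha> E = 0 \<longrightarrow>
            \<not> complex_of_real (\<omega>\<^sub>0 + E) islimpt discrete_spectrum (op_matrix \<omega> lam \<gamma> \<alpha>) \<and>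
            \<not> complex_of_real (\<omega>\<^sub>1 + E) islimpt discrete_spectrum (op_matrix \<omega> lam \<gamma> \<alpha>)) \<and>
         (\<forall>F. F > \<omega>\<^sub>1 + \<gamma> \<and> Phi \<omega> lam \<gamma> \<alpha> F = 0 \<longrightarrow>
            \<not> complex_of_real (\<omega>\<^sub>0 + F) islimpt discrete_spectrum (op_matrix \<omega> lam \<gamma> \<alpha>) \<and>
            \<not> complex_of_real (\<omega>\<^sub>1 + F) islimpt discrete_spectrum (op_matrix \<omega> lam \<gamma> \<alpha>))"
proof -
  note cont = assms(4) and lam = assms(5)
  define D where "D = discrete_spectrum (op_matrix \<omega> lam \<gamma> \<alpha>)"
  define X where "X = {t. complex_of_real t \<in> D}"
  have bdd: "bdd_below (range \<omega>)" "bdd_above (range \<omega>)"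
    using assms(3) by (auto intro: bounded_imp_bdd_below bounded_imp_bdd_above)
  have lo: "\<omega>\<^sub>0 \<le> \<omega> k" and hi: "\<omega> k \<le> \<omega>\<^sub>1" for k
    using bdd unfolding assms(7,8) by (auto intro: cINF_lower cSUP_upper)
  have "\<omega>\<^sub>0 < \<omega>\<^sub>1"
  proof (rule ccontr)
    assume "\<not> \<omega>\<^sub>0 < \<omega>\<^sub>1"
    then have "\<omega> k = \<omega>\<^sub>0" for k using lo[of k] hi[of k] by linarith
    then show False using assms(2) by (auto simp: constant_on_def)
  qed
  have IVT: "\<exists>k. \<omega> k = u" if u: "\<omega>\<^sub>0 < u" "u < \<omega>\<^sub>1" for u
  proof -
    obtain k1 k2 where "\<omega> k1 < u" "u < \<omega> k2"
      using u bdd unfolding assms(7,8) by (auto simp: cINF_less_iff less_cSUP_iff)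
    moreover have "connected (range \<omega>)"
      using cont by (intro connected_continuous_image connected_UNIV)
    ultimately show ?thesis
      using connectedD_interval[of "range \<omega>" "\<omega> k1" "\<omega> k2" u] by force
  qed
  have meas: "\<omega> \<in> borel_measurable borel" using cont by (rule borel_measurable_continuous_onI)
  interpret E: schur \<omega> lam \<alpha> "- \<gamma>" \<gamma> \<omega>\<^sub>0 \<omega>\<^sub>1
    by unfold_locales (use meas lo hi lam in auto)
  \<comment> \<open>Reflection exchanges the bounds: \<open>- \<omega>\<^sub>1\<close> is the lower
    and \<open>- \<omega>\<^sub>0\<close> the upper bound of \<open>- \<omega>\<close>.\<close>
  interpret F: schur "\<lambda>k. - \<omega> k" lam \<alpha> \<gamma> "- \<gamma>" "- \<omega>\<^sub>1" "- \<omega>\<^sub>0"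
    by unfold_locales (use meas lo hi lam in auto)
  have real: "Im z = 0" if "z \<in> D" for z
    using that E.eigenvalue_real by (auto simp: D_def discrete_spectrum_def)
  have two: "complex_of_real u \<in> spectrum (op_matrix \<omega> lam \<gamma> \<alpha>)"
    if "2 * \<omega>\<^sub>0 + \<gamma> < u" "u < 2 * \<omega>\<^sub>1 + \<gamma>" for u
  proof -
    have "\<omega>\<^sub>0 < (u - \<gamma>) / 2" "(u - \<gamma>) / 2 < \<omega>\<^sub>1" using that by simp_all
    then obtain k where "\<omega> k = (u - \<gamma>) / 2" using IVT by blast
    then have "u = 2 * \<omega> k + \<gamma>" by simp
    then show ?thesis using spectrum_two_particles[OF cont lam] by metis
  qed
  have one: "complex_of_real u \<in> spectrum (op_matrix \<omega> lam \<gamma> \<alpha>)"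
    if "\<omega>\<^sub>0 + e < u" "u < \<omega>\<^sub>1 + e" "E.phi e = 0" "E.gap u s" for u e s
  proof -
    have "\<omega>\<^sub>0 < u - e" "u - e < \<omega>\<^sub>1" using that by simp_all
    then obtain k where "\<omega> k = u - e" using IVT by blast
    then have "u = \<omega> k + e" by simp
    then show ?thesis using E.spectrum_one_particle[OF cont that(4) _ that(3)] by blast
  qed
  have X1: "\<not> (2 * \<omega>\<^sub>0 + \<gamma> < t \<and> t < 2 * \<omega>\<^sub>1 + \<gamma>)" if "t \<in> X" for t
    using not_isolated_in_interval[OF _ _ two] that by (auto simp: X_def D_def discrete_spectrum_def)
  have gap_above: "E.gap t (t - 2 * \<omega>\<^sub>1 - \<gamma>)" if "t > 2 * \<omega>\<^sub>1 + \<gamma>" for t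
    unfolding E.gap_def using that hi by (smt (verit))
  have X3: "\<exists>f\<in>L2. \<not> (AE k in lborel. f k = 0) \<and> (AE k in lborel. E.S t f k = 0)"
    if "t \<in> X" "E.gap t s" for t s
    using that E.eigenvalue_kernel by (auto simp: X_def D_def discrete_spectrum_def)
  have "\<not> complex_of_real (\<omega>\<^sub>0 + e) islimpt D \<and> \<not> complex_of_real (\<omega>\<^sub>1 + e) islimpt D"
    if e: "e < \<omega>\<^sub>0 + \<gamma>" "Phi \<omega> lam \<gamma> \<alpha> e = 0" for e
  proof -
    have phi: "E.phi e = 0" using e by (simp add: Phi_def E.phi_def)
    have X2: "\<not> (\<omega>\<^sub>0 + e < t \<and> t < \<omega>\<^sub>1 + e)" if t: "t \<in> X" for t
    proof
      assume "\<omega>\<^sub>0 + e < t \<and> t < \<omega>\<^sub>1 + e"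
      then have "\<not> complex_of_real t isolated_in spectrum (op_matrix \<omega> lam \<gamma> \<alpha>)"
      \<comment> \<open>At the exceptional point \<open>2 * \<omega>\<^sub>0 + \<gamma>\<close>
        neither Weyl sequence is available: there is no gap, and the open interval of
        \<open>two\<close> starts there.\<close>
      proof (intro not_isolated_in_interval[where t' = "2 * \<omega>\<^sub>0 + \<gamma>"])
        fix u assume u: "\<omega>\<^sub>0 + e < u" "u < \<omega>\<^sub>1 + e" "u \<noteq> 2 * \<omega>\<^sub>0 + \<gamma>"
        show "complex_of_real u \<in> spectrum (op_matrix \<omega> lam \<gamma> \<alpha>)"
        proof (cases "u < 2 * \<omega>\<^sub>0 + \<gamma>")
          case True
          then show ?thesis using one[OF u(1,2) phi E.gap_below] by simp
        next
          case False
          \<comment> \<open>From \<open>e < \<omega>\<^sub>0 + \<gamma>\<close> it follows that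
            \<open>u < \<omega>\<^sub>1 + e < 2 * \<omega>\<^sub>1 + \<gamma>\<close>, so
            \<open>u\<close> lies in the interval of \<open>two\<close>.\<close>
          then show ?thesis using u e \<open>\<omega>\<^sub>0 < \<omega>\<^sub>1\<close> by (intro two) auto
        qed
      qed auto
      then show False using t by (simp add: X_def D_def discrete_spectrum_def)
    qed
    have "\<exists>\<delta>>0. finite (X \<inter> ball z \<delta>)" if "z = \<omega>\<^sub>0 + e \<or> z = \<omega>\<^sub>1 + e" for z
      by (rule E.locally_finite_at_thresholds[OF e(1) phi \<open>\<omega>\<^sub>0 < \<omega>\<^sub>1\<close> X1 X2 X3[OF _ E.gap_below] that])
    then show ?thesis
      using real unfolding X_def by (intro conjI not_islimpt_real_set) blast+
  qed
  moreover have "\<not> complex_of_real (\<omega>\<^sub>0 + e) islimpt D \<and> \<not> complex_of_real (\<omega>\<^sub>1 + e) islimpt D"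
    if e: "e > \<omega>\<^sub>1 + \<gamma>" "Phi \<omega> lam \<gamma> \<alpha> e = 0" for e
  proof -
    have phi: "E.phi e = 0" using e by (simp add: Phi_def E.phi_def)
    have X2: "\<not> (\<omega>\<^sub>0 + e < t \<and> t < \<omega>\<^sub>1 + e)" if t: "t \<in> X" for t
    proof
      assume "\<omega>\<^sub>0 + e < t \<and> t < \<omega>\<^sub>1 + e"
      then have "\<not> complex_of_real t isolated_in spectrum (op_matrix \<omega> lam \<gamma> \<alpha>)"
      proof (intro not_isolated_in_interval[where t' = "2 * \<omega>\<^sub>1 + \<gamma>"])
        fix u assume u: "\<omega>\<^sub>0 + e < u" "u < \<omega>\<^sub>1 + e" "u \<noteq> 2 * \<omega>\<^sub>1 + \<gamma>"
        show "complex_of_real u \<in> spectrum (op_matrix \<omega> lam \<gamma> \<alpha>)"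
        proof (cases "u > 2 * \<omega>\<^sub>1 + \<gamma>")
          case True
          then show ?thesis using one[OF u(1,2) phi gap_above] by simp
        next
          case False
          then show ?thesis using u e \<open>\<omega>\<^sub>0 < \<omega>\<^sub>1\<close> by (intro two) auto
        qed
      qed auto
      then show False using t by (simp add: X_def D_def discrete_spectrum_def)
    qed
    have Fres: "F.resC (- t) f p = - E.resC t f p" for t f p
    proof -
      have "- \<omega> (fst p) + - \<omega> (snd p) + - \<gamma> - - t = - (\<omega> (fst p) + \<omega> (snd p) + \<gamma> - t)" by simp
      then show ?thesis unfolding F.resC_def E.resC_def by (simp only: of_real_minus divide_minus_right)
    qed
    have FS: "F.S (- t) f k = - E.S t f k" for t f k
      unfolding F.S_def E.S_def Fres[abs_def] by (simp add: opB_def Fres algebra_simps)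
    have Fphi: "F.phi (- e) = 0"
    proof -
      have "(cmod (lam q))\<^sup>2 / (- \<omega> q + - \<gamma> - - e) = - ((cmod (lam q))\<^sup>2 / (\<omega> q + \<gamma> - e))" for q
        by (simp flip: divide_minus_right)
      then have "F.phi (- e) = - E.phi e"
        unfolding F.phi_def E.phi_def by simp
      with phi show ?thesis by simp
    qed
    \<comment> \<open>After reflection the zero of \<open>F.phi\<close> is \<open>- e\<close>, and
      the negatives of \<open>\<omega>\<^sub>1 + e\<close> and \<open>\<omega>\<^sub>0 + e\<close>
      are the lower and upper thresholds attached to it.\<close>
    have fin: "\<exists>\<delta>>0. finite (uminus ` X \<inter> ball z \<delta>)" if "z = - \<omega>\<^sub>1 + - e \<or> z = - \<omega>\<^sub>0 + - e" for z
    proof (rule F.locally_finite_at_thresholds[OF _ Fphi _ _ _ _ that])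
      fix t assume t: "t \<in> uminus ` X"
      then show "\<not> (2 * - \<omega>\<^sub>1 + - \<gamma> < t \<and> t < 2 * - \<omega>\<^sub>0 + - \<gamma>)"
        using X1 by force
      show "\<not> (- \<omega>\<^sub>1 + - e < t \<and> t < - \<omega>\<^sub>0 + - e)"
        using t X2 by force
      assume "t < 2 * - \<omega>\<^sub>1 + - \<gamma>"
      then have "- t > 2 * \<omega>\<^sub>1 + \<gamma>" by simp
      then show "\<exists>f\<in>L2. \<not> (AE k in lborel. f k = 0) \<and> (AE k in lborel. F.S t f k = 0)"
        using X3[OF _ gap_above] FS[of "- t"] t by force
    qed (use e \<open>\<omega>\<^sub>0 < \<omega>\<^sub>1\<close> in auto)
    have "\<exists>\<delta>>0. finite (X \<inter> ball z \<delta>)" if "z = \<omega>\<^sub>0 + e \<or> z = \<omega>\<^sub>1 + e" for z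
    proof -
      obtain \<delta> where \<delta>: "\<delta> > 0" "finite (uminus ` X \<inter> ball (- z) \<delta>)"
        using fin[of "- z"] \<open>z = \<omega>\<^sub>0 + e \<or> z = \<omega>\<^sub>1 + e\<close> by auto
      have "X \<inter> ball z \<delta> \<subseteq> uminus ` (uminus ` X \<inter> ball (- z) \<delta>)"
        by (force simp: dist_real_def image_iff)
      then show ?thesis using \<delta> by (meson finite_imageI finite_subset)
    qed
    then show ?thesis
      using real unfolding X_def by (intro conjI not_islimpt_real_set) blast+
  qed
  ultimately show ?thesis unfolding D_def by blast
qed

end
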